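(* There exist universal constants $C_0,c>0$ such that the following holds. Let $\mathbb{K}\in\{\mathbb{R},\mathbb{C}\}$ and let $A\in\mathbb{K}^{m\times n}$ be a fixed nonzero matrix with stable rank $r=\|A\|_F^2/\|A\|_2^2$ and rank $k$. Suppose $\tilde p=(\tilde p_i)_{i=1}^m$ and $\tilde q=(\tilde q_j)_{j=1}^n$ are probability distributions satisfying $$\tilde p_i\ge\alpha_i^2\frac{\|A(i,:)\|_2^2}{\|A\|_F^2}\quad(1\le i\le m),\qquad \tilde q_j\ge\beta_j^2\frac{\|A(:,j)\|_2^2}{\|A\|_F^2}\quad(1\le j\le n)$$ for some constants $\alpha_i,\beta_j>0$ (with the convention that $\alpha_i=1$ if $A(i,:)=0$ and $\beta_j=1$ if $A(:,j)=0$). Let $\alpha=\min_i\alpha_i$ and $\beta=\min_j\beta_j$, and let $\varepsilon,\delta\in(0,1)$ be such that $\frac{\varepsilon^2\sqrt\delta}{2}<\min\{\alpha,\beta\}$ and $\varepsilon<\frac{\sigma_k(A)}{\|A\|_2}$. Let $d_1\in\{1,\dots,m\}$, $d_2\in\{1,\dots,n\}$ satisfy $$d_1,d_2\ \ge\ C_0\,\Big(\frac{r}{\varepsilon^4\delta}\Big)\log\Big(\frac{r}{\varepsilon^4\delta}\Big).$$ Let $R=A(I,:)$ be the $d_1\times n$ row submatrix of $A$ consisting of $d_1$ rows of $A$ chosen independently with replacement according to $\tilde p$, let $C=A(:,J)$ be the $m\times d_2$ column submatrix consisting of $d_2$ columns of $A$ chosen independently with replacement according to $\tilde q$ (the choice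 of columns being independent of the choice of rows), and let $U=A(I,J)$. Then with probability at least $$\big(1-2\exp(-c\alpha^2/\delta)\big)\big(1-2\exp(-c\beta^2/\delta)\big),$$ the following hold: $$\operatorname{rank}(U)=k\quad\text{and}\quad A=CU^\dagger R.$$ Moreover, the same conclusion holds if $I$ and $J$ are replaced by $I_0$ and $J_0$, the indices of $I$ and $J$ without repeated entries (and $R,C,U$ are replaced by $A(I_0,:)$, $A(:,J_0)$, $A(I_0,J_0)$).
   Context: $\|\cdot\|_2$ is the spectral norm of a matrix (Euclidean norm of a vector), $\|\cdot\|_F$ the Frobenius norm, $\sigma_1(A)\ge\sigma_2(A)\ge\cdots$ the singular values, and $U^\dagger$ the Moore--Penrose pseudoinverse. $A(i,:)$ and $A(:,j)$ are the $i$-th row and $j$-th column of $A$. For index lists $I=(i_1,\dots,i_{d_1})$, $J=(j_1,\dots,j_{d_2})$ (possibly with repetitions), $A(I,:)$ has $a$-th row $A(i_a,:)$, $A(:,J)$ has $b$-th column $A(:,j_b)$, and $A(I,J)$ has $(a,b)$ entry $A_{i_a,j_b}$.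
   Formalization: Each factor 1−2exp(−cα²/δ) and 1−2exp(−cβ²/δ) of the probability bound is replaced by 0 when it is negative; otherwise two negative factors would multiply to a spurious positive bound, for which the claim as stated is false. *)

theory Defs
  imports
    "HOL-Probability.Probability_Mass_Function"
    "Jordan_Normal_Form.Schur_Decomposition"
    "Jordan_Normal_Form.DL_Rank"
begin

text \<open>
  Matrices are those of Jordan_Normal_Form, whose dimensions are values rather than types, so that
  they can be quantified after the universal constants. The sort
  \<open>{conjugatable_ordered_field, real_normed_field}\<close> covers both \<open>real\<close> and \<open>complex\<close>.
  Rows and columns are indexed from \<open>0\<close>.
\<close>

definition euclid_norm :: "'a::real_normed_field vec \<Rightarrow> real" where
  "euclid_norm v = sqrt (\<Sum>i<dim_vec v. (norm (v $ i))\<^sup>2)"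

definition frobenius_norm :: "'a::real_normed_field mat \<Rightarrow> real" where
  "frobenius_norm A = sqrt (\<Sum>i<dim_row A. \<Sum>j<dim_col A. (norm (A $$ (i, j)))\<^sup>2)"

definition spectral_norm :: "'a::real_normed_field mat \<Rightarrow> real" where
  "spectral_norm A =
     Sup {euclid_norm (A *\<^sub>v x) | x. x \<in> carrier_vec (dim_col A) \<and> euclid_norm x \<le> 1}"

definition mat_rank :: "'a::field mat \<Rightarrow> nat" where
  "mat_rank A = vec_space.rank (dim_row A) A"

definition stable_rank :: "'a::real_normed_field mat \<Rightarrow> real" where
  "stable_rank A = (frobenius_norm A)\<^sup>2 / (spectral_norm A)\<^sup>2"

text \<open>
  The singular values are the square roots of the eigenvalues of \<open>A\<^sup>* A\<close>, with algebraic
  multiplicity, in decreasing order. These eigenvalues are nonnegative reals embedded in the scalar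
  field, so \<open>norm\<close> recovers their value. There are \<open>dim_col A\<close> of them.
\<close>

definition singular_values ::
  "'a::{conjugatable_ordered_field, real_normed_field} mat \<Rightarrow> real list" where
  "singular_values A =
     rev (sorted_list_of_multiset
       (image_mset (\<lambda>z. sqrt (norm z)) (proots (char_poly (mat_adjoint A * A)))))"

text \<open>\<open>sing_val A k\<close> is \<open>\<sigma>\<^sub>k(A)\<close> for \<open>k \<ge> 1\<close>.\<close>

definition sing_val ::
  "'a::{conjugatable_ordered_field, real_normed_field} mat \<Rightarrow> nat \<Rightarrow> real" where
  "sing_val A k = singular_values A ! (k - 1)"

definition is_moore_penrose :: "'a::conjugatable_field mat \<Rightarrow> 'a mat \<Rightarrow> bool" where
  "is_moore_penrose A X \<longleftrightarrow>
     X \<in> carrier_mat (dim_col A) (dim_row A) \<and>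
     A * X * A = A \<and> X * A * X = X \<and>
     mat_adjoint (A * X) = A * X \<and> mat_adjoint (X * A) = X * A"

definition pinv :: "'a::conjugatable_field mat \<Rightarrow> 'a mat" where
  "pinv A = (THE X. is_moore_penrose A X)"

definition select_rows :: "'a mat \<Rightarrow> nat list \<Rightarrow> 'a mat" where
  "select_rows A I = mat (length I) (dim_col A) (\<lambda>(a, j). A $$ (I ! a, j))"

definition select_cols :: "'a mat \<Rightarrow> nat list \<Rightarrow> 'a mat" where
  "select_cols A J = mat (dim_row A) (length J) (\<lambda>(i, b). A $$ (i, J ! b))"

definition select_mat :: "'a mat \<Rightarrow> nat list \<Rightarrow> nat list \<Rightarrow> 'a mat" where
  "select_mat A I J = mat (length I) (length J) (\<lambda>(a, b). A $$ (I ! a, J ! b))"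

text \<open>
  \<open>row_sampling A p \<alpha>\<close>: the distribution \<open>p\<close> on the row indices dominates the squared-length
  distribution with constants \<open>\<alpha>\<^sub>i\<close>; similarly for the columns.
\<close>

definition row_sampling ::
  "'a::real_normed_field mat \<Rightarrow> nat pmf \<Rightarrow> (nat \<Rightarrow> real) \<Rightarrow> bool" where
  "row_sampling A p \<alpha> \<longleftrightarrow>
     set_pmf p \<subseteq> {..<dim_row A} \<and>
     (\<forall>i<dim_row A. 0 < \<alpha> i \<and>
        (row A i = 0\<^sub>v (dim_col A) \<longrightarrow> \<alpha> i = 1) \<and>
        pmf p i \<ge> (\<alpha> i)\<^sup>2 * ((euclid_norm (row A i))\<^sup>2 / (frobenius_norm A)\<^sup>2))"

definition col_sampling ::
  "'a::real_normed_field mat \<Rightarrow> nat pmf \<Rightarrow> (nat \<Rightarrow> real) \<Rightarrow> bool" where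
  "col_sampling A q \<beta> \<longleftrightarrow>
     set_pmf q \<subseteq> {..<dim_col A} \<and>
     (\<forall>j<dim_col A. 0 < \<beta> j \<and>
        (col A j = 0\<^sub>v (dim_row A) \<longrightarrow> \<beta> j = 1) \<and>
        pmf q j \<ge> (\<beta> j)\<^sup>2 * ((euclid_norm (col A j))\<^sup>2 / (frobenius_norm A)\<^sup>2))"

text \<open>
  The law of \<open>(I, J)\<close>: \<open>d1\<close> row indices drawn independently with replacement from \<open>p\<close> and,
  independently of them, \<open>d2\<close> column indices drawn independently with replacement from \<open>q\<close>.
\<close>

definition index_pmf ::
  "nat \<Rightarrow> nat pmf \<Rightarrow> nat \<Rightarrow> nat pmf \<Rightarrow> (nat list \<times> nat list) pmf" where
  "index_pmf d1 p d2 q = pair_pmf (replicate_pmf d1 p) (replicate_pmf d2 q)"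

definition exact_cur :: "'a::conjugatable_field mat \<Rightarrow> nat list \<Rightarrow> nat list \<Rightarrow> bool" where
  "exact_cur A I J \<longleftrightarrow>
     mat_rank (select_mat A I J) = mat_rank A \<and>
     A = select_cols A J * pinv (select_mat A I J) * select_rows A I"

text \<open>
  Lower bound \<open>1 - 2 exp (- c a\<^sup>2 / \<delta>)\<close> for a single probability, read as the trivial bound \<open>0\<close>
  when it is negative. Without the truncation, two vacuous (negative) bounds for the rows and for
  the columns would multiply to a spurious positive bound for their conjunction, which is false:
  take \<open>A\<close> to be \<open>diag(1, s)\<close> padded with zeros, \<open>s\<close> slightly above \<open>\<epsilon>\<close>,
  \<open>\<alpha> = \<beta> = 3/5 * \<epsilon>\<^sup>2 * sqrt \<delta>\<close>, second row and column drawn with the least admissible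
  probability, least admissible \<open>d1\<close> and \<open>d2\<close>, and \<open>\<epsilon>\<close> tending to \<open>0\<close>: the untruncated product
  tends to \<open>1\<close>, while the success probability tends to \<open>0\<close>.
\<close>

definition prob_bound :: "real \<Rightarrow> real \<Rightarrow> real \<Rightarrow> real" where
  "prob_bound c a \<delta> = max 0 (1 - 2 * exp (- c * a\<^sup>2 / \<delta>))"

end

theory Submission
  imports Defs
    "HOL-Probability.Product_PMF"
    "HOL-Library.Function_Algebras"
    "HOL-Computational_Algebra.Fundamental_Theorem_Algebra"
    "HOL-Combinatorics.Permutations"
begin

text \<open>
  No matrix concentration is needed. Let \<open>W\<close> be the span of the rows drawn so far and \<open>g\<close> the dimension
  it still misses. Comparing with \<open>k\<close> left singular vectors whose singular values are at least
  \<open>\<sigma>\<^sub>k\<close> shows that the rows outside \<open>W\<close> have squared norms summing to at least \<open>g * \<sigma>\<^sub>k\<^sup>2\<close>, so the next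
  draw enlarges \<open>W\<close> with probability at least \<open>\<theta> * g\<close>, where
  \<open>\<theta> = \<alpha>\<^sup>2 * \<sigma>\<^sub>k\<^sup>2 / \<parallel>A\<parallel>\<^sub>F\<^sup>2 \<ge> \<alpha>\<^sup>2 * \<epsilon>\<^sup>2 / r\<close>. Hence the expected missing dimension after \<open>d\<close> draws is at most
  \<open>k * (1 - \<theta>)\<^sup>d\<close>, and Markov's inequality bounds the probability that the drawn rows do not span the
  row space. When the claimed bound is positive, \<open>\<alpha>\<^sup>2 / \<delta>\<close> is large, and this together with
  \<open>k \<le> r / \<epsilon>\<^sup>2\<close> makes the assumed \<open>d\<close> sufficient. The same holds for columns, and once rows and columns
  both span, \<open>A = Y R = C X\<close> gives \<open>A = Y U X\<close> and so \<open>C U\<^sup>\<dagger> R = Y U U\<^sup>\<dagger> U X = A\<close>.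
\<close>

section \<open>Spans and ranks\<close>

text \<open>The sampling weights see only squared row lengths, whereas the conclusion concerns rank,
  and a short row can be indispensable. The left singular vectors mediate: written as the columns of
  an m by k matrix, they give its rows total squared length k, and rows of it that lie in a
  w-dimensional space carry at most w of this total. A row of \<open>A\<close> is at least s times
  as long as the corresponding row of that matrix, where s is the k-th singular value. So each
  missing dimension guarantees squared length s^2 outside the span, whichever rows were drawn
  before. This uniformity in the history is what allows a one-step argument with independent draws.

  Markov's inequality costs a factor k, which is paid for by the logarithm in the assumed number of
  draws. Dimensions are counted over the scalar field of \<open>A\<close>, but the singular vectors
  are complex even for real \<open>A\<close>; the two fields are compared by an inequality in the
  favourable direction.\<close>

unbundle no vec_syntax

interpretation fun_vs: vector_space "\<lambda>(c::'a::field) (f::nat \<Rightarrow> 'a) i. c * f i"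
  by unfold_locales (auto simp: fun_eq_iff algebra_simps)

lemma sum_fun_apply: "(\<Sum>x\<in>S. f x) i = (\<Sum>x\<in>S. f x i :: 'a::comm_monoid_add)"
  by (induction S rule: infinite_finite_induct) auto

text \<open>The ambient function space has infinite dimension, hence the finiteness of
  \<open>W\<close>: a basis chosen inside \<open>W\<close> is then a finite spanning set, and its
  size bounds the dimension of \<open>V\<close>.\<close>

lemma fun_vs_dim_mono:
  assumes "V \<subseteq> fun_vs.span W" "finite W"
  shows "fun_vs.dim V \<le> fun_vs.dim W"
proof -
  obtain B where B: "B \<subseteq> W" "fun_vs.independent B" "W \<subseteq> fun_vs.span B" "card B = fun_vs.dim W"
    using fun_vs.basis_exists by blast
  have "fun_vs.span W \<subseteq> fun_vs.span B"
    using B(3) by (simp add: fun_vs.span_minimal)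
  with assms B(1) have "fun_vs.dim V \<le> card B"
    by (intro fun_vs.dim_le_card) (auto intro: finite_subset)
  with B(4) show ?thesis by simp
qed

lemma fun_vs_dim_insert:
  assumes "finite W" "x \<notin> fun_vs.span W"
  shows "fun_vs.dim (insert x W) = Suc (fun_vs.dim W)"
proof -
  obtain B where B: "B \<subseteq> W" "fun_vs.independent B" "W \<subseteq> fun_vs.span B" "card B = fun_vs.dim W"
    using fun_vs.basis_exists by blast
  have fB: "finite B" using B(1) assms(1) finite_subset by blast
  have x: "x \<notin> fun_vs.span B" using assms(2) fun_vs.span_mono[OF B(1)] by blast
  have "fun_vs.dim (insert x W) = card (insert x B)"
  proof (rule fun_vs.dim_unique)
    show "insert x B \<subseteq> insert x W" using B(1) by blast
    show "insert x W \<subseteq> fun_vs.span (insert x B)"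
      using B(3) fun_vs.span_mono[of B "insert x B"] fun_vs.span_base by blast
    show "fun_vs.independent (insert x B)" using fun_vs.independent_insertI[OF x B(2)] .
  qed auto
  also have "\<dots> = Suc (card B)" using fB x fun_vs.span_base by (subst card_insert_disjoint) auto
  finally show ?thesis using B(4) by simp
qed

text \<open>Coefficients are indexed by \<open>S\<close> and not by the image, so that
  \<open>f\<close> may take equal values: repeated draws are different indices with the same
  row.\<close>

lemma fun_vs_span_imageE:
  assumes "x \<in> fun_vs.span (f ` S)" "finite S"
  obtains c where "x = (\<lambda>j. \<Sum>i\<in>S. c i * f i j)"
proof -
  have "\<exists>c. x = (\<lambda>j. \<Sum>i\<in>S. c i * f i j)"
    using assms(1)
  proof (induction rule: fun_vs.span_induct_alt)
    case base
    then show ?case by (intro exI[of _ "\<lambda>_. 0"]) (auto simp: fun_eq_iff)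
  next
    case (step a v y)
    then obtain c where c: "y = (\<lambda>j. \<Sum>i\<in>S. c i * f i j)" by auto
    obtain s where s: "s \<in> S" "v = f s" using step by auto
    have "(\<Sum>i\<in>S. (c i + (if i = s then a else 0)) * f i j) = a * v j + y j" for j
    proof -
      have "(\<Sum>i\<in>S. (c i + (if i = s then a else 0)) * f i j)
          = (\<Sum>i\<in>S. c i * f i j) + (\<Sum>i\<in>S. if i = s then a * f i j else 0)"
        unfolding sum.distrib[symmetric] by (intro sum.cong) (auto simp: algebra_simps)
      then show ?thesis using s assms(2) c by simp
    qed
    then show ?case by (intro exI[of _ "\<lambda>i. c i + (if i = s then a else 0)"]) (auto simp: fun_eq_iff)
  qed
  with that show ?thesis by blast
qed

lemma fun_vs_span_imageI:
  "(\<lambda>j. \<Sum>i\<in>S. c i * f i j) \<in> fun_vs.span (f ` S)"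
proof -
  have "(\<Sum>i\<in>S. (\<lambda>j. c i * f i j)) \<in> fun_vs.span (f ` S)"
    by (intro fun_vs.span_sum fun_vs.span_scale fun_vs.span_base) auto
  also have "(\<Sum>i\<in>S. (\<lambda>j. c i * f i j)) = (\<lambda>j. \<Sum>i\<in>S. c i * f i j)"
    by (auto simp: sum_fun_apply fun_eq_iff)
  finally show ?thesis .
qed

text \<open>
  Rows and columns are padded with zeros to functions on \<open>nat\<close>, so that span and dimension are those of
  \<open>HOL.Vector_Spaces\<close>, uniformly in the size of the matrix.
\<close>

definition row_fun :: "'a::zero mat \<Rightarrow> nat \<Rightarrow> nat \<Rightarrow> 'a" where
  "row_fun A i = (\<lambda>j. if i < dim_row A \<and> j < dim_col A then A $$ (i, j) else 0)"

definition col_fun :: "'a::zero mat \<Rightarrow> nat \<Rightarrow> nat \<Rightarrow> 'a" where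
  "col_fun A j = (\<lambda>i. row_fun A i j)"

lemma row_fun_transpose: "row_fun (transpose_mat A) = col_fun A"
  by (auto simp: row_fun_def col_fun_def fun_eq_iff)

lemma col_fun_transpose: "col_fun (transpose_mat A) = row_fun A"
  by (auto simp: row_fun_def col_fun_def fun_eq_iff)

text \<open>Expand every column in a basis of the column space. Read along a row, the same identity
  writes that row as a combination of the coefficient functions, and there is one of these per basis
  element.\<close>

lemma dim_rows_le_dim_cols:
  fixes A :: "'a::field mat"
  shows "fun_vs.dim (row_fun A ` {..<dim_row A}) \<le> fun_vs.dim (col_fun A ` {..<dim_col A})"
proof -
  obtain B where B: "B \<subseteq> col_fun A ` {..<dim_col A}" "fun_vs.independent B"
      "col_fun A ` {..<dim_col A} \<subseteq> fun_vs.span B" "card B = fun_vs.dim (col_fun A ` {..<dim_col A})"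
    using fun_vs.basis_exists by blast
  have fB: "finite B" using B(1) finite_subset by blast
  have "\<exists>c. col_fun A j = (\<lambda>i. \<Sum>b\<in>B. c b * b i)" if "j < dim_col A" for j
  proof -
    have "col_fun A j \<in> fun_vs.span ((\<lambda>b. b) ` B)" using that B(3) by auto
    then show ?thesis using fun_vs_span_imageE[OF _ fB] by metis
  qed
  then obtain c where c: "\<And>j. j < dim_col A \<Longrightarrow> col_fun A j = (\<lambda>i. \<Sum>b\<in>B. c j b * b i)"
    by metis
  \<comment> \<open>Zero beyond the last column, in agreement with the padding of
    \<open>row_fun\<close>.\<close>
  define g where "g b = (\<lambda>j. if j < dim_col A then c j b else 0)" for b
  have "row_fun A i \<in> fun_vs.span (g ` B)" for i
  proof -
    have "row_fun A i = (\<lambda>j. \<Sum>b\<in>B. b i * g b j)"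
    proof
      fix j
      show "row_fun A i j = (\<Sum>b\<in>B. b i * g b j)"
      proof (cases "j < dim_col A")
        case True
        have "row_fun A i j = col_fun A j i" by (simp add: col_fun_def)
        then show ?thesis using True c by (simp add: g_def mult.commute)
      qed (simp add: g_def row_fun_def)
    qed
    then show ?thesis by (simp only: fun_vs_span_imageI)
  qed
  then have "fun_vs.dim (row_fun A ` {..<dim_row A}) \<le> card (g ` B)"
    using fB by (intro fun_vs.dim_le_card) auto
  also have "\<dots> \<le> card B" using fB card_image_le by blast
  finally show ?thesis using B(4) by simp
qed

lemma dim_rows_eq_dim_cols:
  fixes A :: "'a::field mat"
  shows "fun_vs.dim (row_fun A ` {..<dim_row A}) = fun_vs.dim (col_fun A ` {..<dim_col A})"
  using dim_rows_le_dim_cols[of A] dim_rows_le_dim_cols[of "transpose_mat A"]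
  by (simp add: row_fun_transpose col_fun_transpose)

section \<open>Agreement of \<open>mat_rank\<close> with the dimension of the padded columns\<close>

definition vec_fun :: "'a::zero vec \<Rightarrow> nat \<Rightarrow> 'a" where
  "vec_fun v = (\<lambda>i. if i < dim_vec v then v $ i else 0)"

lemma vec_fun_inj: "inj_on vec_fun (carrier_vec n)"
proof (rule inj_onI)
  fix v w :: "'a vec" assume c: "v \<in> carrier_vec n" "w \<in> carrier_vec n" and e: "vec_fun v = vec_fun w"
  show "v = w"
  proof (rule eq_vecI)
    fix i assume "i < dim_vec w"
    then show "v $ i = w $ i" using c fun_cong[OF e, of i] by (auto simp: vec_fun_def)
  qed (use c in auto)
qed

text \<open>The bridge between the two notions of independence: the rank of the definitions counts
  independent sets in \<open>vec_space\<close>, the sampling argument works in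
  \<open>fun_vs\<close>. Padding is linear and injective on vectors of a fixed length, so linear
  relations correspond.\<close>

lemma independent_image_vec_fun:
  fixes T :: "'a::field vec set"
  assumes T: "T \<subseteq> carrier_vec n" "finite T"
  shows "fun_vs.independent (vec_fun ` T) \<longleftrightarrow>
    \<not> module.lin_dep class_ring (module_vec TYPE('a) n) T"
proof -
  interpret vec_space "TYPE('a)" n .
  have inj: "inj_on vec_fun T" using vec_fun_inj T(1) inj_on_subset by blast
  have lc: "lincomb a T = 0\<^sub>v n \<longleftrightarrow> (\<Sum>v\<in>vec_fun ` T. (\<lambda>i. a (the_inv_into T vec_fun v) * v i)) = (\<lambda>i. 0)" for a
  proof -
    have e: "(\<Sum>v\<in>vec_fun ` T. (\<lambda>i. a (the_inv_into T vec_fun v) * v i)) i = (\<Sum>v\<in>T. a v * vec_fun v i)" for i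
      unfolding sum_fun_apply by (subst sum.reindex[OF inj]) (auto simp: the_inv_into_f_f[OF inj] intro!: sum.cong)
    have "lincomb a T = 0\<^sub>v n \<longleftrightarrow> (\<forall>i<n. (\<Sum>v\<in>T. a v * v $ i) = 0)"
      using T by (simp add: Matrix.vec_eq_iff lincomb_index lincomb_dim)
    \<comment> \<open>Coordinates from \<open>n\<close> on vanish in every padded vector and add no
      constraint.\<close>
    also have "\<dots> \<longleftrightarrow> (\<forall>i. (\<Sum>v\<in>T. a v * vec_fun v i) = 0)"
    proof -
      have "(\<Sum>v\<in>T. a v * vec_fun v i) = (if i < n then \<Sum>v\<in>T. a v * v $ i else 0)" for i
        using T by (auto simp: vec_fun_def intro!: sum.cong sum.neutral)
      then show ?thesis by auto
    qed
    finally show ?thesis using e by (auto simp: fun_eq_iff)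
  qed
  have "lin_dep T \<longleftrightarrow> (\<exists>a. lincomb a T = 0\<^sub>v n \<and> (\<exists>v\<in>T. a v \<noteq> 0))"
  proof
    assume "lin_dep T"
    then show "\<exists>a. lincomb a T = 0\<^sub>v n \<and> (\<exists>v\<in>T. a v \<noteq> 0)"
      using finite_lin_dep[OF T(2)] T(1) by fastforce
  next
    assume "\<exists>a. lincomb a T = 0\<^sub>v n \<and> (\<exists>v\<in>T. a v \<noteq> 0)"
    then show "lin_dep T" unfolding lin_dep_def using T(2) by auto
  qed
  also have "\<dots> \<longleftrightarrow> fun_vs.dependent (vec_fun ` T)"
    unfolding lc
  proof (subst fun_vs.dependent_finite)
    show "finite (vec_fun ` T)" using T by simp
    show "(\<exists>a. (\<Sum>v\<in>vec_fun ` T. (\<lambda>i. a (the_inv_into T vec_fun v) * v i)) = (\<lambda>i. 0) \<and> (\<exists>v\<in>T. a v \<noteq> 0))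
      \<longleftrightarrow> (\<exists>u. (\<exists>v\<in>vec_fun ` T. u v \<noteq> 0) \<and> (\<Sum>v\<in>vec_fun ` T. (\<lambda>i. u v * v i)) = 0)" (is "?L \<longleftrightarrow> ?R")
    proof
      assume ?L
      then obtain a v where a: "(\<Sum>v\<in>vec_fun ` T. (\<lambda>i. a (the_inv_into T vec_fun v) * v i)) = (\<lambda>i. 0)" "v \<in> T" "a v \<noteq> 0" by blast
      show ?R by (rule exI[of _ "\<lambda>v. a (the_inv_into T vec_fun v)"])
         (use a in \<open>simp add: zero_fun_def the_inv_into_f_f[OF inj], blast\<close>)
    next
      assume ?R
      then obtain u v where u: "(\<Sum>v\<in>vec_fun ` T. (\<lambda>i. u v * v i)) = 0" "v \<in> T" "u (vec_fun v) \<noteq> 0" by blast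
      have "(\<Sum>v\<in>vec_fun ` T. (\<lambda>i. u (vec_fun (the_inv_into T vec_fun v)) * v i)) = (\<Sum>v\<in>vec_fun ` T. (\<lambda>i. u v * v i))"
        by (intro sum.cong refl) (auto simp: the_inv_into_f_f[OF inj])
      then show ?L by (intro exI[of _ "\<lambda>v. u (vec_fun v)"]) (use u in \<open>auto simp: zero_fun_def\<close>)
    qed
  qed
  finally show ?thesis by simp
qed

text \<open>The rank is the size of a maximal independent set of columns. Transported along
  \<open>vec_fun\<close>, independence is kept, and maximality says that no column lies outside the
  span, so the image is a basis.\<close>

lemma mat_rank_eq_dim_cols:
  fixes A :: "'a::field mat"
  shows "mat_rank A = fun_vs.dim (col_fun A ` {..<dim_col A})"
proof -
  define n where "n = dim_row A"
  interpret vec_space "TYPE('a)" n .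
  have A: "A \<in> carrier_mat n (dim_col A)" by (auto simp: n_def)
  have sub: "set (cols A) \<subseteq> carrier_vec n" using cols_dim n_def by blast
  obtain S where S: "maximal S (\<lambda>T. T \<subseteq> set (cols A) \<and> lin_indpt T)"
    using maximal_exists[of "(\<lambda>T. T \<subseteq> set (cols A) \<and> lin_indpt T)" "card (set (cols A))" "{}"]
    by (meson List.finite_set card_mono empty_iff empty_subsetI finite_lin_indpt2 rev_finite_subset)
  have S1: "S \<subseteq> set (cols A)" "lin_indpt S"
    using S unfolding maximal_def by simp_all
  have S2: "T = S" if "S \<subseteq> T" "T \<subseteq> set (cols A)" "lin_indpt T" for T
    using S that unfolding maximal_def by simp
  have fS: "finite S" using S1(1) finite_subset by blast
  have rank: "mat_rank A = card S" using rank_card_indpt[OF A S] by (simp add: mat_rank_def n_def)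
  have img: "vec_fun ` set (cols A) = col_fun A ` {..<dim_col A}"
  proof -
    have "set (cols A) = col A ` {..<dim_col A}" by (auto simp: cols_def)
    then have "vec_fun ` set (cols A) = (\<lambda>j. vec_fun (col A j)) ` {..<dim_col A}" by auto
    also have "\<dots> = col_fun A ` {..<dim_col A}"
      by (intro image_cong) (auto simp: vec_fun_def col_fun_def row_fun_def fun_eq_iff)
    finally show ?thesis .
  qed
  have inj: "inj_on vec_fun (set (cols A))" using vec_fun_inj sub inj_on_subset by blast
  have ind: "fun_vs.independent (vec_fun ` S)"
    using independent_image_vec_fun[of S n] S1 sub fS by auto
  have "vec_fun v \<in> fun_vs.span (vec_fun ` S)" if v: "v \<in> set (cols A)" for v
  proof (rule ccontr)
    assume n: "vec_fun v \<notin> fun_vs.span (vec_fun ` S)"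
    then have "fun_vs.independent (vec_fun ` insert v S)"
      using fun_vs.independent_insertI[OF n ind] by simp
    then have "lin_indpt (insert v S)"
      using independent_image_vec_fun[of "insert v S" n] S1 sub fS v by auto
    then have "insert v S = S" using S1 v by (intro S2) auto
    then have "vec_fun v \<in> vec_fun ` S" by blast
    then show False using n fun_vs.span_base by metis
  qed
  then have "vec_fun ` set (cols A) \<subseteq> fun_vs.span (vec_fun ` S)" by (rule image_subsetI)
  then have "fun_vs.dim (vec_fun ` set (cols A)) = card (vec_fun ` S)"
    by (rule fun_vs.dim_unique[OF image_mono[OF S1(1)] _ ind refl])
  also have "\<dots> = card S" using inj S1(1) by (intro card_image) (rule inj_on_subset)
  finally show ?thesis using rank img by simp
qed

lemma mat_rank_eq_dim_rows:
  fixes A :: "'a::field mat"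
  shows "mat_rank A = fun_vs.dim (row_fun A ` {..<dim_row A})"
  unfolding dim_rows_eq_dim_cols by (rule mat_rank_eq_dim_cols)

lemma mat_rank_le_dim_col: "mat_rank A \<le> dim_col A"
  using vec_space.rank_le_nc[of A "dim_row A" "dim_col A"] unfolding mat_rank_def by blast

lemma mat_rank_mult_le_left:
  fixes M :: "'a::field mat"
  assumes M: "M \<in> carrier_mat a b" and N: "N \<in> carrier_mat b c"
  shows "mat_rank (M * N) \<le> mat_rank M"
  unfolding mat_rank_eq_dim_cols
proof (rule fun_vs_dim_mono)
  show "col_fun (M * N) ` {..<dim_col (M * N)} \<subseteq> fun_vs.span (col_fun M ` {..<dim_col M})"
  proof (rule image_subsetI)
    fix j assume j: "j \<in> {..<dim_col (M * N)}"
    have "col_fun (M * N) j = (\<lambda>i. \<Sum>l\<in>{..<dim_col M}. N $$ (l, j) * col_fun M l i)"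
    proof
      fix i
      show "col_fun (M * N) j i = (\<Sum>l\<in>{..<dim_col M}. N $$ (l, j) * col_fun M l i)"
      proof (cases "i < a")
        case True
        then have "col_fun (M * N) j i = (\<Sum>l\<in>{..<b}. M $$ (i, l) * N $$ (l, j))"
          using M N j by (simp add: col_fun_def row_fun_def scalar_prod_def atLeast0LessThan)
        also have "\<dots> = (\<Sum>l\<in>{..<b}. N $$ (l, j) * col_fun M l i)"
          using M True by (intro sum.cong refl) (simp add: col_fun_def row_fun_def)
        finally show ?thesis using M by simp
      qed (use M N in \<open>simp add: col_fun_def row_fun_def\<close>)
    qed
    then show "col_fun (M * N) j \<in> fun_vs.span (col_fun M ` {..<dim_col M})"
      by (simp only: fun_vs_span_imageI)
  qed
qed simp

lemma mat_rank_transpose: "mat_rank (transpose_mat A) = mat_rank A"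
  unfolding mat_rank_eq_dim_cols[of "transpose_mat A"] mat_rank_eq_dim_rows[of A]
  by (simp add: col_fun_transpose)

lemma mat_rank_mult_le_right:
  fixes M :: "'a::field mat"
  assumes M: "M \<in> carrier_mat a b" and N: "N \<in> carrier_mat b c"
  shows "mat_rank (M * N) \<le> mat_rank N"
proof -
  have "mat_rank (transpose_mat N * transpose_mat M) \<le> mat_rank (transpose_mat N)"
    using M N by (intro mat_rank_mult_le_left) auto
  then show ?thesis
    by (simp add: mat_rank_transpose transpose_mult[OF M N, symmetric])
qed

section \<open>Moore-Penrose inverses and exact CUR decompositions\<close>

lemma dim_mat_adjoint [simp]: "dim_row (mat_adjoint A) = dim_col A" "dim_col (mat_adjoint A) = dim_row A"
  by (auto simp: mat_adjoint_def mat_of_rows_def)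

lemma mat_adjoint_carrier [simp]: "A \<in> carrier_mat m n \<Longrightarrow> mat_adjoint A \<in> carrier_mat n m"
  by (intro carrier_matI) auto

lemma mat_adjoint_index [simp]:
  "i < dim_col A \<Longrightarrow> j < dim_row A \<Longrightarrow> mat_adjoint A $$ (i, j) = conjugate (A $$ (j, i))"
  by (auto simp: mat_adjoint_def mat_of_rows_def)

lemma mat_adjoint_adjoint [simp]: "mat_adjoint (mat_adjoint A) = A"
  by (rule eq_matI) auto

text \<open>\<open>conjugate 1\<close> is idempotent and nonzero.\<close>

lemma conjugate_one [simp]: "conjugate (1::'a::conjugatable_field) = 1"
proof -
  have "conjugate (1::'a) * conjugate 1 = conjugate 1"
    by (metis conjugate_dist_mul mult_1)
  then show ?thesis by (metis conjugate_zero_iff mult_cancel_right1 zero_neq_one)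
qed

lemma mat_adjoint_one [simp]: "mat_adjoint (1\<^sub>m n :: 'a::conjugatable_field mat) = 1\<^sub>m n"
  by (rule eq_matI) auto

lemma mult_index_sum:
  "A \<in> carrier_mat m n \<Longrightarrow> B \<in> carrier_mat n p \<Longrightarrow> i < m \<Longrightarrow> j < p \<Longrightarrow>
    (A * B) $$ (i, j) = (\<Sum>l<n. A $$ (i, l) * B $$ (l, j))"
  by (auto simp: scalar_prod_def atLeast0LessThan)

lemma mult_vec_index_sum:
  "A \<in> carrier_mat m n \<Longrightarrow> v \<in> carrier_vec n \<Longrightarrow> i < m \<Longrightarrow>
    (A *\<^sub>v v) $ i = (\<Sum>l<n. A $$ (i, l) * v $ l)"
  by (auto simp: scalar_prod_def atLeast0LessThan)

lemma mat_adjoint_mult: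
  fixes M :: "'a::conjugatable_field mat"
  assumes M: "M \<in> carrier_mat a b" and N: "N \<in> carrier_mat b c"
  shows "mat_adjoint (M * N) = mat_adjoint N * mat_adjoint M"
proof (rule eq_matI)
  fix i j assume "i < dim_row (mat_adjoint N * mat_adjoint M)" "j < dim_col (mat_adjoint N * mat_adjoint M)"
  then have ij: "i < c" "j < a" using M N by auto
  have "mat_adjoint (M * N) $$ (i, j) = conjugate ((M * N) $$ (j, i))"
    using ij M N by (intro mat_adjoint_index) auto
  also have "\<dots> = (\<Sum>l<b. mat_adjoint N $$ (i, l) * mat_adjoint M $$ (l, j))"
    unfolding mult_index_sum[OF M N ij(2,1)] using ij M N
    by (simp add: sum_conjugate conjugate_dist_mul mult.commute)
  also have "\<dots> = (mat_adjoint N * mat_adjoint M) $$ (i, j)"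
    using ij M N by (subst mult_index_sum[of _ c b _ a]) auto
  finally show "mat_adjoint (M * N) $$ (i, j) = (mat_adjoint N * mat_adjoint M) $$ (i, j)" .
qed (use M N in auto)

lemma adjoint_mult_vec_cscalar_prod:
  fixes F :: "'a::conjugatable_field mat"
  assumes F: "F \<in> carrier_mat m t" and y: "y \<in> carrier_vec m" and x: "x \<in> carrier_vec t"
  shows "(mat_adjoint F *\<^sub>v y) \<bullet> conjugate x = y \<bullet> conjugate (F *\<^sub>v x)"
proof -
  have "(mat_adjoint F *\<^sub>v y) \<bullet> conjugate x = (\<Sum>i<t. (\<Sum>j<m. conjugate (F $$ (j, i)) * y $ j) * conjugate (x $ i))"
    using F x y mult_vec_index_sum[OF mat_adjoint_carrier[OF F] y]
    by (auto simp: scalar_prod_def[of _ "conjugate x"] atLeast0LessThan intro!: sum.cong)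
  also have "\<dots> = (\<Sum>j<m. \<Sum>i<t. y $ j * (conjugate (F $$ (j, i)) * conjugate (x $ i)))"
    unfolding sum_distrib_right by (subst sum.swap) (simp add: mult_ac)
  also have "\<dots> = y \<bullet> conjugate (F *\<^sub>v x)"
    using F x y mult_vec_index_sum[OF F x]
    by (auto simp: scalar_prod_def[of y] atLeast0LessThan sum_conjugate conjugate_dist_mul sum_distrib_left intro!: sum.cong)
  finally show ?thesis .
qed

text \<open>If the Gram matrix kills \<open>x\<close>, then the inner product of
  \<open>F *\<^sub>v x\<close> with itself is zero, so \<open>x\<close> is in the kernel of
  \<open>F\<close>; this is where positivity of the conjugation enters. The inverse is self-adjoint
  because the Gram matrix is.\<close>

lemma gram_inverse:
  fixes F :: "'a::conjugatable_ordered_field mat"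
  assumes F: "F \<in> carrier_mat m t"
    and inj: "\<And>x. x \<in> carrier_vec t \<Longrightarrow> F *\<^sub>v x = 0\<^sub>v m \<Longrightarrow> x = 0\<^sub>v t"
  obtains N where "N \<in> carrier_mat t t" "mat_adjoint F * F * N = 1\<^sub>m t" "N * (mat_adjoint F * F) = 1\<^sub>m t"
    "mat_adjoint N = N"
proof -
  let ?M = "mat_adjoint F * F"
  have M: "?M \<in> carrier_mat t t" using F by auto
  have "det ?M \<noteq> 0"
  proof
    assume "det ?M = 0"
    then obtain x where x: "x \<in> carrier_vec t" "x \<noteq> 0\<^sub>v t" "?M *\<^sub>v x = 0\<^sub>v t"
      using det_0_iff_vec_prod_zero_field[OF M] by auto
    have Fx: "F *\<^sub>v x \<in> carrier_vec m" using F x by auto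
    have "mat_adjoint F *\<^sub>v (F *\<^sub>v x) = 0\<^sub>v t"
      using x assoc_mult_mat_vec[OF mat_adjoint_carrier[OF F] F x(1)] by simp
    then have "(F *\<^sub>v x) \<bullet> conjugate (F *\<^sub>v x) = 0"
      using adjoint_mult_vec_cscalar_prod[OF F Fx x(1)] x(1) by simp
    then have "F *\<^sub>v x = 0\<^sub>v m" using conjugate_square_eq_0_vec[OF Fx] by simp
    with inj x show False by blast
  qed
  then have "?M \<in> Units (ring_mat TYPE('a) t ())" by (rule det_non_zero_imp_unit[OF M])
  then obtain N where N: "N \<in> carrier_mat t t" "?M * N = 1\<^sub>m t" "N * ?M = 1\<^sub>m t"
    by (auto simp: Units_def ring_mat_simps)
  have "mat_adjoint ?M = ?M" using mat_adjoint_mult[OF mat_adjoint_carrier[OF F] F] by simp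
  then have "mat_adjoint N * ?M = 1\<^sub>m t"
    using mat_adjoint_mult[OF M N(1)] N(2) by simp
  then have "mat_adjoint N * ?M * N = N" using N(1) by simp
  moreover have "mat_adjoint N * ?M * N = mat_adjoint N"
    using N M assoc_mult_mat[OF mat_adjoint_carrier[OF N(1)] M N(1)] by simp
  ultimately show ?thesis using that N by simp
qed

text \<open>The columns of \<open>F\<close> are a basis taken among the columns of \<open>U\<close>,
  and \<open>G\<close> holds the coordinates of all columns in it. The right inverse
  \<open>H\<close> certifies the full row rank of \<open>G\<close>, in a form that survives taking
  adjoints.\<close>

lemma full_rank_factorization:
  fixes U :: "'a::field mat"
  assumes U: "U \<in> carrier_mat m n"
  obtains t F G H where "F \<in> carrier_mat m t" "G \<in> carrier_mat t n" "H \<in> carrier_mat n t"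
    "U = F * G" "G * H = 1\<^sub>m t" "\<forall>x\<in>carrier_vec t. F *\<^sub>v x = 0\<^sub>v m \<longrightarrow> x = 0\<^sub>v t"
proof -
  obtain B where B: "B \<subseteq> col_fun U ` {..<n}" "fun_vs.independent B" "col_fun U ` {..<n} \<subseteq> fun_vs.span B"
      "card B = fun_vs.dim (col_fun U ` {..<n})"
    using fun_vs.basis_exists by blast
  have fB: "finite B" using B(1) finite_subset by blast
  define t where "t = card B"
  obtain b where b: "bij_betw b {..<t} B"
    using fB ex_bij_betw_nat_finite[of B] by (auto simp: t_def atLeast0LessThan)
  have bB: "b l \<in> B" if "l < t" for l using bij_betw_apply[OF b] that by simp
  have b_inj: "b l = b l' \<longleftrightarrow> l = l'" if "l < t" "l' < t" for l l'
    using b that by (auto simp: bij_betw_def inj_on_def)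
  have "\<exists>j<n. col_fun U j = b l" if "l < t" for l
    using subsetD[OF B(1) bB[OF that]] by (metis imageE lessThan_iff)
  then obtain js where js: "\<And>l. l < t \<Longrightarrow> js l < n" "\<And>l. l < t \<Longrightarrow> col_fun U (js l) = b l" by metis
  define rep where "rep j = fun_vs.representation B (col_fun U j)" for j
  define F where "F = mat m t (\<lambda>(i, l). b l i)"
  define G where "G = mat t n (\<lambda>(l, j). rep j (b l))"
  \<comment> \<open>\<open>H\<close> picks out the columns that form the basis; their coordinate
    vectors are the unit vectors.\<close>
  define H where "H = mat n t (\<lambda>(j, l). if j = js l then 1 else 0 :: 'a)"
  have c: "F \<in> carrier_mat m t" "G \<in> carrier_mat t n" "H \<in> carrier_mat n t"
    by (auto simp: F_def G_def H_def)
  have "U = F * G"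
  proof (rule eq_matI)
    fix i j assume "i < dim_row (F * G)" "j < dim_col (F * G)"
    then have ij: "i < m" "j < n" using c by auto
    have "col_fun U j = (\<Sum>v\<in>B. (\<lambda>i. rep j v * v i))"
      unfolding rep_def
      by (rule fun_vs.sum_representation_eq[OF B(2) _ fB order_refl, symmetric]) (use B(3) ij in blast)
    then have "col_fun U j i = (\<Sum>v\<in>B. rep j v * v i)" by (simp add: sum_fun_apply)
    also have "\<dots> = (\<Sum>l<t. rep j (b l) * b l i)" by (rule sum.reindex_bij_betw[OF b, symmetric])
    also have "\<dots> = (F * G) $$ (i, j)"
      unfolding mult_index_sum[OF c(1,2) ij] using ij by (intro sum.cong) (auto simp: F_def G_def mult.commute)
    finally show "U $$ (i, j) = (F * G) $$ (i, j)" using ij U by (simp add: col_fun_def row_fun_def)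
  qed (use U c in auto)
  moreover have "G * H = 1\<^sub>m t"
  proof (rule eq_matI)
    fix l l' assume "l < dim_row (1\<^sub>m t :: 'a mat)" "l' < dim_col (1\<^sub>m t :: 'a mat)"
    then have l: "l < t" "l' < t" by auto
    have "(G * H) $$ (l, l') = (\<Sum>j<n. if j = js l' then rep j (b l) else 0)"
      unfolding mult_index_sum[OF c(2,3) l] using l by (intro sum.cong) (auto simp: G_def H_def)
    also have "\<dots> = rep (js l') (b l)" using js(1) l by simp
    also have "\<dots> = (if l = l' then 1 else 0)"
      using fun_vs.representation_basis[OF B(2) bB[OF l(2)]] l b_inj by (simp add: rep_def js(2))
    finally show "(G * H) $$ (l, l') = 1\<^sub>m t $$ (l, l')" using l by simp
  qed (use c in auto)
  moreover have "x = 0\<^sub>v t" if x: "x \<in> carrier_vec t" and Fx: "F *\<^sub>v x = 0\<^sub>v m" for x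
  proof -
    define u where "u v = x $ the_inv_into {..<t} b v" for v
    have u: "u (b l) = x $ l" if "l < t" for l
      using b that by (auto simp: u_def bij_betw_def the_inv_into_f_f)
    have b0: "b l i = 0" if "l < t" "\<not> i < m" for l i
      using fun_cong[OF js(2)[OF that(1)], of i] U that(2) by (simp add: col_fun_def row_fun_def)
    have "(\<Sum>v\<in>B. u v * v i) = 0" for i
    proof -
      have "(\<Sum>v\<in>B. u v * v i) = (\<Sum>l<t. x $ l * b l i)"
        using u by (subst sum.reindex_bij_betw[OF b, symmetric]) auto
      also have "\<dots> = 0"
      proof (cases "i < m")
        case True
        have "(F *\<^sub>v x) $ i = (\<Sum>l<t. b l i * x $ l)"
          unfolding mult_vec_index_sum[OF c(1) x True] using True by (auto simp: F_def)
        then show ?thesis using Fx True by (simp add: mult.commute)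
      qed (simp add: b0)
      finally show ?thesis .
    qed
    then have "(\<Sum>v\<in>B. (\<lambda>i. u v * v i)) = 0" by (auto simp: fun_eq_iff sum_fun_apply)
    then have uz: "u v = 0" if "v \<in> B" for v
      by (rule fun_vs.independentD[OF B(2) fB order_refl _ that])
    show ?thesis
    proof (rule eq_vecI)
      fix l assume "l < dim_vec (0\<^sub>v t :: 'a vec)"
      then have "l < t" by simp
      then show "x $ l = 0\<^sub>v t $ l" using u uz[OF bB] by simp
    qed (use x in simp)
  qed
  ultimately show ?thesis using that c by blast
qed

text \<open>\<open>A * X\<close> and \<open>A * Y\<close> are self-adjoint idempotents with the same
  range, and \<open>X * A\<close> and \<open>Y * A\<close> are self-adjoint idempotents with the
  same kernel. Such projections coincide, and \<open>X = X * A * X\<close> then turns into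
  \<open>Y\<close>.\<close>

lemma moore_penrose_unique:
  fixes A :: "'a::conjugatable_field mat"
  assumes X: "is_moore_penrose A X" and Y: "is_moore_penrose A Y"
  shows "X = Y"
proof -
  define m n where "m = dim_row A" and "n = dim_col A"
  have c: "A \<in> carrier_mat m n" "X \<in> carrier_mat n m" "Y \<in> carrier_mat n m"
    using X Y by (auto simp: is_moore_penrose_def m_def n_def)
  have AXAX: "(A * Y) * (A * X) = A * X"
  proof -
    have "(A * Y) * (A * X) = (A * Y * A) * X" using c by (subst assoc_mult_mat[of _ m m _ n]) auto
    then show ?thesis using Y by (simp add: is_moore_penrose_def)
  qed
  have AXAY: "(A * X) * (A * Y) = A * Y"
  proof -
    have "(A * X) * (A * Y) = (A * X * A) * Y" using c by (subst assoc_mult_mat[of _ m m _ n]) auto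
    then show ?thesis using X by (simp add: is_moore_penrose_def)
  qed
  have AX: "A * X = A * Y"
    using arg_cong[OF AXAX, of mat_adjoint] mat_adjoint_mult[of "A * Y" m m "A * X" m] AXAY c X Y
    by (simp add: is_moore_penrose_def)
  have XAYA: "(X * A) * (Y * A) = X * A"
  proof -
    have "(X * A) * (Y * A) = X * (A * Y * A)"
      using c by (subst assoc_mult_mat[of _ n m _ n]) (auto simp: assoc_mult_mat[of A m n Y m A n])
    then show ?thesis using Y by (simp add: is_moore_penrose_def)
  qed
  have YAXA: "(Y * A) * (X * A) = Y * A"
  proof -
    have "(Y * A) * (X * A) = Y * (A * X * A)"
      using c by (subst assoc_mult_mat[of _ n m _ n]) (auto simp: assoc_mult_mat[of A m n X m A n])
    then show ?thesis using X by (simp add: is_moore_penrose_def)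
  qed
  have XA: "X * A = Y * A"
    using arg_cong[OF XAYA, of mat_adjoint] mat_adjoint_mult[of "X * A" n n "Y * A" n] YAXA c X Y
    by (simp add: is_moore_penrose_def)
  have "X = X * A * X" using X by (simp add: is_moore_penrose_def)
  also have "\<dots> = Y * (A * X)" unfolding XA using c by simp
  also have "\<dots> = Y * A * Y" unfolding AX using c by simp
  also have "\<dots> = Y" using Y by (simp add: is_moore_penrose_def)
  finally show ?thesis .
qed

text \<open>The classical formula through a full-rank factorization: for \<open>A = F * G\<close>
  the inverse is the product of the adjoint of \<open>G\<close>, the inverses of the two Gram
  matrices of \<open>G\<close> and \<open>F\<close>, and the adjoint of \<open>F\<close>.\<close>

lemma moore_penrose_exists:
  fixes A :: "'a::conjugatable_ordered_field mat"
  shows "\<exists>X. is_moore_penrose A X"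
proof -
  define m n where "m = dim_row A" and "n = dim_col A"
  have A: "A \<in> carrier_mat m n" by (auto simp: m_def n_def)
  obtain t F G H where F: "F \<in> carrier_mat m t" and G: "G \<in> carrier_mat t n" and H: "H \<in> carrier_mat n t"
    and AFG: "A = F * G" and GH: "G * H = 1\<^sub>m t"
    and inj: "\<forall>x\<in>carrier_vec t. F *\<^sub>v x = 0\<^sub>v m \<longrightarrow> x = 0\<^sub>v t"
    using full_rank_factorization[OF A] by metis
  define F' G' where "F' = mat_adjoint F" and "G' = mat_adjoint G"
  have F': "F' \<in> carrier_mat t m" and G': "G' \<in> carrier_mat n t"
    using F G by (auto simp: F'_def G'_def)
  obtain N where N: "N \<in> carrier_mat t t" "F' * F * N = 1\<^sub>m t" "N * (F' * F) = 1\<^sub>m t" "mat_adjoint N = N"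
    unfolding F'_def by (rule gram_inverse[OF F inj[rule_format]])
  have inj': "x = 0\<^sub>v t" if x: "x \<in> carrier_vec t" and z: "G' *\<^sub>v x = 0\<^sub>v n" for x
  proof -
    \<comment> \<open>The adjoint of a right inverse of \<open>G\<close> is a left inverse of
      \<open>G'\<close>, which makes \<open>G'\<close> injective and its Gram matrix
      invertible.\<close>
    have "mat_adjoint H * G' = 1\<^sub>m t" using mat_adjoint_mult[OF G H] GH by (simp add: G'_def)
    then have "x = mat_adjoint H *\<^sub>v (G' *\<^sub>v x)"
      using assoc_mult_mat_vec[OF mat_adjoint_carrier[OF H] G' x] x by simp
    also have "mat_adjoint H *\<^sub>v (G' *\<^sub>v x) = 0\<^sub>v t"
      unfolding z using H by (intro eq_vecI) auto
    finally show ?thesis .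
  qed
  have G'': "mat_adjoint G' = G" by (simp add: G'_def)
  obtain K where K: "K \<in> carrier_mat t t" "G * G' * K = 1\<^sub>m t" "K * (G * G') = 1\<^sub>m t" "mat_adjoint K = K"
    by (rule gram_inverse[OF G' inj', unfolded G''])
  \<comment> \<open>Here \<open>N\<close> inverts \<open>F' * F\<close> and \<open>K\<close> inverts
    \<open>G * G'\<close>. The products collapse to \<open>A * X = F * N * F'\<close> and
    \<open>X * A = G' * K * G\<close>, which are visibly self-adjoint.\<close>
  define X where "X = G' * (K * (N * F'))"
  have NF: "N * F' \<in> carrier_mat t m" "K * (N * F') \<in> carrier_mat t m" "K * G \<in> carrier_mat t n"
    using N K F' G by auto
  have X: "X \<in> carrier_mat n m" using G' NF by (simp add: X_def)
  have GX: "G * X = N * F'"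
  proof -
    have "G * X = (G * G') * (K * (N * F'))"
      unfolding X_def by (rule assoc_mult_mat[OF G G' NF(2), symmetric])
    also have "\<dots> = (G * G' * K) * (N * F')"
      by (rule assoc_mult_mat[OF mult_carrier_mat[OF G G'] K(1) NF(1), symmetric])
    finally show ?thesis unfolding K(2) left_mult_one_mat[OF NF(1)] .
  qed
  have NFFG: "(N * F') * (F * G) = G"
  proof -
    have "(N * F') * (F * G) = (N * F' * F) * G" by (rule assoc_mult_mat[OF NF(1) F G, symmetric])
    also have "N * F' * F = N * (F' * F)" by (rule assoc_mult_mat[OF N(1) F' F])
    finally show ?thesis unfolding N(3) left_mult_one_mat[OF G] .
  qed
  have AX: "A * X = F * (N * F')"
  proof -
    have "A * X = F * (G * X)" unfolding AFG by (rule assoc_mult_mat[OF F G X])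
    also note GX
    finally show ?thesis .
  qed
  have XA: "X * A = G' * (K * G)"
  proof -
    have "X * A = G' * (K * (N * F') * A)"
      unfolding X_def by (rule assoc_mult_mat[OF G' NF(2) A])
    also have "K * (N * F') * A = K * ((N * F') * (F * G))"
      unfolding AFG by (rule assoc_mult_mat[OF K(1) NF(1) mult_carrier_mat[OF F G]])
    also note NFFG
    finally show ?thesis .
  qed
  have "A * X * A = A"
  proof -
    have "A * X * A = F * (N * F') * (F * G)" unfolding AX by (simp only: AFG)
    also have "\<dots> = F * ((N * F') * (F * G))"
      by (rule assoc_mult_mat[OF F NF(1) mult_carrier_mat[OF F G]])
    also note NFFG
    finally show ?thesis by (simp add: AFG)
  qed
  moreover have "X * A * X = X"
  proof -
    have "X * A * X = G' * (K * G) * X" by (simp add: XA)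
    also have "\<dots> = G' * (K * G * X)" by (rule assoc_mult_mat[OF G' NF(3) X])
    also have "K * G * X = K * (G * X)" by (rule assoc_mult_mat[OF K(1) G X])
    also note GX
    finally show ?thesis by (simp add: X_def)
  qed
  moreover have "mat_adjoint (A * X) = A * X"
  proof -
    have "mat_adjoint (N * F') = F * N" using mat_adjoint_mult[OF N(1) F'] N(4) by (simp add: F'_def)
    then show ?thesis
      unfolding AX mat_adjoint_mult[OF F NF(1)] using assoc_mult_mat[OF F N(1) F'] by (simp add: F'_def)
  qed
  moreover have "mat_adjoint (X * A) = X * A"
  proof -
    have "mat_adjoint (K * G) = G' * K" using mat_adjoint_mult[OF K(1) G] K(4) by (simp add: G'_def)
    then show ?thesis
      unfolding XA mat_adjoint_mult[OF G' NF(3)] using assoc_mult_mat[OF G' K(1) G] by (simp add: G'')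
  qed
  ultimately show ?thesis using X by (auto simp: is_moore_penrose_def m_def n_def)
qed

lemma is_moore_penrose_pinv:
  fixes A :: "'a::conjugatable_ordered_field mat"
  shows "is_moore_penrose A (pinv A)"
  unfolding pinv_def
  by (rule theI', rule ex_ex1I) (use moore_penrose_exists moore_penrose_unique in blast)+

section \<open>From spanning rows and columns to an exact decomposition\<close>

lemma mat_rank_select_rows_le:
  fixes A :: "'a::field mat"
  assumes "set I \<subseteq> {..<dim_row A}"
  shows "mat_rank (select_rows A I) \<le> mat_rank A"
  unfolding mat_rank_eq_dim_rows
proof (rule fun_vs_dim_mono)
  have row: "row_fun (select_rows A I) a = row_fun A (I ! a)" if "a < length I" for a
  proof -
    have "I ! a < dim_row A" using that assms nth_mem by blast
    then show ?thesis using that by (auto simp: row_fun_def select_rows_def fun_eq_iff)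
  qed
  have "row_fun (select_rows A I) ` {..<dim_row (select_rows A I)} \<subseteq> row_fun A ` {..<dim_row A}"
  proof (intro image_subsetI)
    fix a assume "a \<in> {..<dim_row (select_rows A I)}"
    then have a: "a < length I" by (simp add: select_rows_def)
    then have "I ! a \<in> {..<dim_row A}" using assms nth_mem by blast
    then show "row_fun (select_rows A I) a \<in> row_fun A ` {..<dim_row A}"
      unfolding row[OF a] by (rule imageI)
  qed
  then show "row_fun (select_rows A I) ` {..<dim_row (select_rows A I)} \<subseteq> fun_vs.span (row_fun A ` {..<dim_row A})"
    using fun_vs.span_superset by blast
qed simp

lemma select_cols_transpose:
  "set J \<subseteq> {..<dim_col A} \<Longrightarrow> select_cols A J = transpose_mat (select_rows (transpose_mat A) J)"
  using nth_mem by (intro eq_matI) (fastforce simp: select_cols_def select_rows_def)+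

lemma rows_spanning_factor:
  fixes A :: "'a::field mat"
  assumes A: "A \<in> carrier_mat m n" and I: "set I \<subseteq> {..<m}"
    and span: "row_fun A ` {..<m} \<subseteq> fun_vs.span (row_fun A ` set I)"
  obtains Y where "Y \<in> carrier_mat m (length I)" "A = Y * select_rows A I"
proof -
  have eq: "row_fun A ` set I = (\<lambda>a. row_fun A (I ! a)) ` {..<length I}"
    by (simp add: set_conv_nth setcompr_eq_image image_image lessThan_def)
  have "\<exists>c. row_fun A i = (\<lambda>j. \<Sum>a<length I. c a * row_fun A (I ! a) j)" if "i < m" for i
  proof -
    have "row_fun A i \<in> fun_vs.span ((\<lambda>a. row_fun A (I ! a)) ` {..<length I})"
      using span that unfolding eq by auto
    then show ?thesis by (rule fun_vs_span_imageE) auto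
  qed
  then obtain c where c: "\<And>i. i < m \<Longrightarrow> row_fun A i = (\<lambda>j. \<Sum>a<length I. c i a * row_fun A (I ! a) j)"
    by metis
  define Y where "Y = mat m (length I) (\<lambda>(i, a). c i a)"
  have Y: "Y \<in> carrier_mat m (length I)" by (simp add: Y_def)
  have R: "select_rows A I \<in> carrier_mat (length I) n" using A by (auto simp: select_rows_def)
  have "A = Y * select_rows A I"
  proof (rule eq_matI)
    fix i j assume "i < dim_row (Y * select_rows A I)" "j < dim_col (Y * select_rows A I)"
    then have ij: "i < m" "j < n" using Y R by auto
    have "A $$ (i, j) = row_fun A i j" using ij A by (simp add: row_fun_def)
    also have "\<dots> = (\<Sum>a<length I. Y $$ (i, a) * select_rows A I $$ (a, j))"
      unfolding c[OF ij(1)]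
    proof (rule sum.cong)
      fix a assume "a \<in> {..<length I}"
      then have a: "a < length I" and "I ! a < m" using I nth_mem by auto
      then show "c i a * row_fun A (I ! a) j = Y $$ (i, a) * select_rows A I $$ (a, j)"
        using ij A by (simp add: Y_def select_rows_def row_fun_def)
    qed simp
    also have "\<dots> = (Y * select_rows A I) $$ (i, j)" by (rule mult_index_sum[OF Y R ij, symmetric])
    finally show "A $$ (i, j) = (Y * select_rows A I) $$ (i, j)" .
  qed (use A Y R in auto)
  with that Y show ?thesis by blast
qed

text \<open>The hypotheses depend on \<open>I\<close> and \<open>J\<close> only through their sets.
  One event therefore settles both the sampled lists and their versions without repeated
  entries.\<close>

lemma exact_cur_if_spanning:
  fixes A :: "'a::conjugatable_ordered_field mat"
  assumes A: "A \<in> carrier_mat m n" and I: "set I \<subseteq> {..<m}" and J: "set J \<subseteq> {..<n}"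
    and rows: "row_fun A ` {..<m} \<subseteq> fun_vs.span (row_fun A ` set I)"
    and cols: "col_fun A ` {..<n} \<subseteq> fun_vs.span (col_fun A ` set J)"
  shows "exact_cur A I J"
proof -
  let ?R = "select_rows A I" and ?C = "select_cols A J" and ?U = "select_mat A I J"
  have R: "?R \<in> carrier_mat (length I) n" and C: "?C \<in> carrier_mat m (length J)"
    and U: "?U \<in> carrier_mat (length I) (length J)"
    using A by (auto simp: select_rows_def select_cols_def select_mat_def)
  obtain Y where Y: "Y \<in> carrier_mat m (length I)" "A = Y * ?R"
    using rows_spanning_factor[OF A I rows] .
  obtain Z where Z: "Z \<in> carrier_mat n (length J)" "transpose_mat A = Z * select_rows (transpose_mat A) J"
    using rows_spanning_factor[of "transpose_mat A" n m J] A J cols by (auto simp: row_fun_transpose)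
  define X where "X = transpose_mat Z"
  have X: "X \<in> carrier_mat (length J) n" using Z by (simp add: X_def)
  have ACX: "A = ?C * X"
  proof -
    have RT: "select_rows (transpose_mat A) J \<in> carrier_mat (length J) m"
      using A by (auto simp: select_rows_def)
    have "A = transpose_mat (Z * select_rows (transpose_mat A) J)" using Z(2) by (metis transpose_transpose)
    also have "\<dots> = transpose_mat (select_rows (transpose_mat A) J) * X"
      by (simp add: transpose_mult[OF Z(1) RT] X_def)
    finally show ?thesis using A J by (simp add: select_cols_transpose)
  qed
  \<comment> \<open>Restrict \<open>A = C * X\<close> to the rows listed in \<open>I\<close>;
    dually, \<open>CYU\<close> below restricts \<open>A = Y * R\<close> to the columns listed in
    \<open>J\<close>.\<close>
  have RUX: "?R = ?U * X"
  proof (rule eq_matI)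
    fix a j assume "a < dim_row (?U * X)" "j < dim_col (?U * X)"
    then have aj: "a < length I" "j < n" using U X by auto
    then have Ia: "I ! a < m" using I nth_mem by auto
    have "?R $$ (a, j) = (?C * X) $$ (I ! a, j)" using aj A ACX by (simp add: select_rows_def)
    also have "\<dots> = (\<Sum>b<length J. ?C $$ (I ! a, b) * X $$ (b, j))"
      by (rule mult_index_sum[OF C X Ia aj(2)])
    also have "\<dots> = (\<Sum>b<length J. ?U $$ (a, b) * X $$ (b, j))"
      using Ia aj A by (intro sum.cong) (auto simp: select_cols_def select_mat_def)
    also have "\<dots> = (?U * X) $$ (a, j)" by (rule mult_index_sum[OF U X aj, symmetric])
    finally show "?R $$ (a, j) = (?U * X) $$ (a, j)" .
  qed (use U X R in auto)
  have CYU: "?C = Y * ?U"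
  proof (rule eq_matI)
    fix i b assume "i < dim_row (Y * ?U)" "b < dim_col (Y * ?U)"
    then have ib: "i < m" "b < length J" using U Y by auto
    then have Jb: "J ! b < n" using J nth_mem by auto
    have "?C $$ (i, b) = (Y * ?R) $$ (i, J ! b)" using ib A Y(2) by (simp add: select_cols_def)
    also have "\<dots> = (\<Sum>a<length I. Y $$ (i, a) * ?R $$ (a, J ! b))"
      by (rule mult_index_sum[OF Y(1) R ib(1) Jb])
    also have "\<dots> = (\<Sum>a<length I. Y $$ (i, a) * ?U $$ (a, b))"
      using Jb ib A by (intro sum.cong) (auto simp: select_rows_def select_mat_def)
    also have "\<dots> = (Y * ?U) $$ (i, b)" by (rule mult_index_sum[OF Y(1) U ib, symmetric])
    finally show "?C $$ (i, b) = (Y * ?U) $$ (i, b)" .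
  qed (use U Y C in auto)
  have AYUX: "A = Y * (?U * X)" using Y(2) RUX by simp
  have "mat_rank A \<le> mat_rank (?U * X)"
    by (subst AYUX, rule mat_rank_mult_le_right[OF Y(1)]) (use U X in auto)
  also have "\<dots> \<le> mat_rank ?U" by (rule mat_rank_mult_le_left[OF U X])
  finally have 1: "mat_rank A \<le> mat_rank ?U" .
  \<comment> \<open>\<open>U\<close> selects columns of \<open>R\<close>, and \<open>R\<close>
    selects rows of \<open>A\<close>: two applications of the selection bound give the missing
    inequality between the ranks.\<close>
  have UT: "transpose_mat ?U = select_rows (transpose_mat ?R) J"
  proof (rule eq_matI)
    fix b a assume "b < dim_row (select_rows (transpose_mat ?R) J)" "a < dim_col (select_rows (transpose_mat ?R) J)"
    then have ba: "b < length J" "a < length I" using R by (auto simp: select_rows_def)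
    then have "J ! b < n" using J nth_mem by blast
    then show "transpose_mat ?U $$ (b, a) = select_rows (transpose_mat ?R) J $$ (b, a)"
      using ba A by (simp add: select_mat_def select_rows_def)
  qed (use A in \<open>auto simp: select_mat_def select_rows_def\<close>)
  have "mat_rank ?U = mat_rank (transpose_mat ?U)" by (simp add: mat_rank_transpose)
  also have "\<dots> \<le> mat_rank (transpose_mat ?R)"
    unfolding UT by (rule mat_rank_select_rows_le) (use R J in auto)
  also have "\<dots> = mat_rank ?R" by (rule mat_rank_transpose)
  also have "\<dots> \<le> mat_rank A" by (rule mat_rank_select_rows_le) (use A I in auto)
  finally have 2: "mat_rank ?U = mat_rank A" using 1 by simp
  let ?P = "pinv ?U"
  have P: "?P \<in> carrier_mat (length J) (length I)" and UPU: "?U * ?P * ?U = ?U"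
    using is_moore_penrose_pinv[of ?U] U by (auto simp: is_moore_penrose_def)
  have "?C * ?P * ?R = Y * ?U * ?P * (?U * X)" using CYU RUX by simp
  also have "\<dots> = Y * (?U * ?P) * (?U * X)" using Y U P by simp
  also have "\<dots> = Y * ((?U * ?P) * (?U * X))"
    using Y(1) U P X by (intro assoc_mult_mat[of _ m "length I" _ "length I" _ n]) auto
  also have "(?U * ?P) * (?U * X) = (?U * ?P * ?U) * X"
    using U P X by (intro assoc_mult_mat[of _ "length I" "length I" _ "length J" _ n, symmetric]) auto
  finally have "A = ?C * ?P * ?R" using AYUX UPU by simp
  with 2 show ?thesis by (simp add: exact_cur_def)
qed

section \<open>Bessel inequality and rows outside a span\<close>

definition cip :: "nat \<Rightarrow> (nat \<Rightarrow> complex) \<Rightarrow> (nat \<Rightarrow> complex) \<Rightarrow> complex" where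
  "cip k x y = (\<Sum>l<k. x l * cnj (y l))"

lemma cip_cnj: "cip k y x = cnj (cip k x y)"
  by (simp add: cip_def mult.commute)

lemma cip_self: "cip k x x = of_real (\<Sum>l<k. (cmod (x l))\<^sup>2)"
  by (simp only: cip_def of_real_sum complex_norm_square)

lemma cip_diff_left: "cip k (\<lambda>l. x l - y l) z = cip k x z - cip k y z"
  by (simp add: cip_def left_diff_distrib sum_subtractf)

lemma cip_scale_left: "cip k (\<lambda>l. c * x l) z = c * cip k x z"
  by (simp add: cip_def sum_distrib_left mult.assoc)

lemma cip_sum_left: "cip k (\<lambda>l. \<Sum>f\<in>F. c f * y f l) z = (\<Sum>f\<in>F. c f * cip k (y f) z)"
  by (simp add: cip_def sum_distrib_right sum_distrib_left mult.assoc sum.swap[of _ F])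

text \<open>An indexed family, so that it covers both singular vectors numbered by
  \<open>{..<k}\<close> and a set of functions indexed by itself.\<close>

definition orthonormal_on :: "nat \<Rightarrow> 'i set \<Rightarrow> ('i \<Rightarrow> nat \<Rightarrow> complex) \<Rightarrow> bool" where
  "orthonormal_on n L e \<longleftrightarrow> (\<forall>l\<in>L. \<forall>l'\<in>L. cip n (e l) (e l') = (if l = l' then 1 else 0))"

lemma orthonormal_on_cnj: "orthonormal_on n L e \<Longrightarrow> orthonormal_on n L (\<lambda>l j. cnj (e l j))"
proof -
  have "cip n (\<lambda>j. cnj (x j)) (\<lambda>j. cnj (y j)) = cnj (cip n x y)" for x y
    by (simp add: cip_def)
  then show "orthonormal_on n L e \<Longrightarrow> orthonormal_on n L (\<lambda>l j. cnj (e l j))"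
    by (simp add: orthonormal_on_def)
qed

lemma norm_orthonormal_sum:
  assumes "finite L" and o: "orthonormal_on m L u"
  shows "(\<Sum>i<m. (cmod (\<Sum>l\<in>L. c l * u l i))\<^sup>2) = (\<Sum>l\<in>L. (cmod (c l))\<^sup>2)"
proof -
  let ?v = "\<lambda>i. \<Sum>l\<in>L. c l * u l i"
  have 1: "cip m (u l) ?v = cnj (c l)" if "l \<in> L" for l
  proof -
    have "cip m ?v (u l) = (\<Sum>l'\<in>L. if l' = l then c l' else 0)"
      unfolding cip_sum_left using o that by (intro sum.cong) (auto simp: orthonormal_on_def)
    also have "\<dots> = c l" using that assms(1) by simp
    finally show ?thesis by (simp add: cip_cnj[of m "u l"])
  qed
  have "complex_of_real (\<Sum>i<m. (cmod (?v i))\<^sup>2) = cip m ?v ?v" by (simp add: cip_self)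
  also have "\<dots> = (\<Sum>l\<in>L. c l * cnj (c l))" unfolding cip_sum_left using 1 by (intro sum.cong) auto
  also have "\<dots> = complex_of_real (\<Sum>l\<in>L. (cmod (c l))\<^sup>2)"
    by (simp only: of_real_sum complex_norm_square)
  finally show ?thesis by (simp only: of_real_eq_iff)
qed

text \<open>The residual \<open>r\<close> of \<open>v\<close> after projection is orthogonal to the
  projection \<open>p\<close>, so its squared length is the difference of the two sides.\<close>

lemma bessel_inequality:
  assumes "finite L" and o: "orthonormal_on n L e"
  shows "(\<Sum>l\<in>L. (cmod (cip n v (e l)))\<^sup>2) \<le> (\<Sum>j<n. (cmod (v j))\<^sup>2)"
proof -
  define p where "p j = (\<Sum>l\<in>L. cip n v (e l) * e l j)" for j
  define r where "r j = v j - p j" for j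
  let ?S = "\<Sum>l\<in>L. (cmod (cip n v (e l)))\<^sup>2"
  have pp: "cip n p p = of_real ?S"
    unfolding cip_self p_def using norm_orthonormal_sum[OF assms] by simp
  have pv: "cip n p v = of_real ?S"
  proof -
    have "cip n p v = (\<Sum>l\<in>L. cip n v (e l) * cip n (e l) v)" unfolding p_def cip_sum_left ..
    also have "\<dots> = (\<Sum>l\<in>L. cip n v (e l) * cnj (cip n v (e l)))"
      by (intro sum.cong refl) (metis cip_cnj)
    also have "\<dots> = of_real ?S" by (simp only: of_real_sum complex_norm_square)
    finally show ?thesis .
  qed
  have vp: "cip n v p = of_real ?S" using pv cip_cnj[of n v p] by simp
  have pr: "cip n p r = 0"
  proof -
    have "cip n r p = 0" using vp pp unfolding r_def cip_diff_left by simp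
    then show ?thesis using cip_cnj[of n p r] by simp
  qed
  have vr: "cip n v r = of_real ((\<Sum>j<n. (cmod (v j))\<^sup>2) - ?S)"
  proof -
    have "cip n r v = of_real ((\<Sum>j<n. (cmod (v j))\<^sup>2) - ?S)"
      using pv cip_self[of n v] unfolding r_def cip_diff_left by simp
    then show ?thesis using cip_cnj[of n v r] by simp
  qed
  have "cip n r r = cip n v r - cip n p r" unfolding r_def cip_diff_left ..
  then have "cip n r r = of_real ((\<Sum>j<n. (cmod (v j))\<^sup>2) - ?S)" using pr vr by simp
  then have "(\<Sum>j<n. (cmod (r j))\<^sup>2) = (\<Sum>j<n. (cmod (v j))\<^sup>2) - ?S"
    unfolding cip_self of_real_eq_iff .
  moreover have "0 \<le> (\<Sum>j<n. (cmod (r j))\<^sup>2)" by (intro sum_nonneg) auto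
  ultimately show ?thesis by simp
qed

text \<open>Gram-Schmidt without assuming independence: a vector already expanded by
  \<open>F\<close> adds nothing, which is why the sizes are only compared by an inequality.
  Expansions are claimed below \<open>k\<close> because \<open>cip\<close> sees only these
  coordinates.\<close>

lemma gram_schmidt_expansion:
  assumes "finite W"
  shows "\<exists>F. finite F \<and> card F \<le> card W \<and> orthonormal_on k F (\<lambda>f. f) \<and>
    (\<forall>w\<in>W. \<forall>l<k. w l = (\<Sum>f\<in>F. cip k w f * f l))"
  using assms
proof (induction W rule: finite_induct)
  case empty
  then show ?case by (intro exI[of _ "{}"]) (auto simp: orthonormal_on_def)
next
  case (insert w W)
  then obtain F where F: "finite F" "card F \<le> card W" "orthonormal_on k F (\<lambda>f. f)"
    "\<forall>w\<in>W. \<forall>l<k. w l = (\<Sum>f\<in>F. cip k w f * f l)"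
    by auto
  define p where "p l = (\<Sum>f\<in>F. cip k w f * f l)" for l
  define r where "r l = w l - p l" for l
  have rf: "cip k r f = 0" if f: "f \<in> F" for f
  proof -
    have "cip k p f = (\<Sum>g\<in>F. if g = f then cip k w g else 0)"
      unfolding p_def cip_sum_left using F(3) f by (intro sum.cong) (auto simp: orthonormal_on_def)
    also have "\<dots> = cip k w f" using f F(1) by simp
    finally show ?thesis unfolding r_def cip_diff_left by simp
  qed
  have fr: "cip k f r = 0" if "f \<in> F" for f
    using rf[OF that] cip_cnj[of k f r] by simp
  show ?case
  proof (cases "\<forall>l<k. r l = 0")
    \<comment> \<open>The residual vanishes on all coordinates that \<open>cip\<close> sees, so
      \<open>F\<close> already expands the new vector.\<close>
    case True
    then have "\<forall>l<k. w l = (\<Sum>f\<in>F. cip k w f * f l)" by (simp add: r_def p_def)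
    then have "\<forall>w\<in>insert w W. \<forall>l<k. w l = (\<Sum>f\<in>F. cip k w f * f l)" using F(4) by blast
    moreover have "card F \<le> card (insert w W)" using F(2) insert.hyps by simp
    ultimately show ?thesis using F(1,3) by blast
  next
    case False
    define q where "q = sqrt (\<Sum>l<k. (cmod (r l))\<^sup>2)"
    have q2: "q\<^sup>2 = (\<Sum>l<k. (cmod (r l))\<^sup>2)" unfolding q_def by (simp add: sum_nonneg)
    have q0: "q \<noteq> 0"
    proof
      assume "q = 0"
      then have z: "(\<Sum>l<k. (cmod (r l))\<^sup>2) = 0" using q2 by simp
      have "\<forall>l\<in>{..<k}. (cmod (r l))\<^sup>2 = 0"
        using z by (subst (asm) sum_nonneg_eq_0_iff) auto
      with False show False by auto
    qed
    define g where "g l = (1 / of_real q) * r l" for l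
    have rr: "cip k r r = (of_real q)\<^sup>2" unfolding cip_self q2[symmetric] by simp
    have g_left: "cip k g x = (1 / of_real q) * cip k r x" for x
      unfolding g_def by (rule cip_scale_left)
    have g_right: "cip k x g = (1 / of_real q) * cip k x r" for x
      using cip_cnj[of k x g] cip_cnj[of k x r] g_left[of x] by simp
    have gg: "cip k g g = 1"
      unfolding g_left g_right rr using q0 by (simp add: power2_eq_square)
    have gf: "cip k g f = 0" "cip k f g = 0" if "f \<in> F" for f
      using rf[OF that] fr[OF that] by (simp_all add: g_left g_right)
    have gF: "g \<notin> F" using gf(1)[of g] gg by auto
    have o: "orthonormal_on k (insert g F) (\<lambda>f. f)"
      unfolding orthonormal_on_def using F(3) gg gf gF by (auto simp: orthonormal_on_def)
    have "v l = (\<Sum>f\<in>insert g F. cip k v f * f l)" if v: "v \<in> insert w W" and l: "l < k" for v l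
    proof (cases "v = w")
      case True
      have "cip k r r = cip k w r - cip k p r" unfolding r_def cip_diff_left ..
      moreover have "cip k p r = 0"
        unfolding p_def cip_sum_left using fr by (intro sum.neutral) simp
      ultimately have "cip k w r = of_real q * of_real q" using rr by (simp add: power2_eq_square)
      then have "cip k w g = of_real q" unfolding g_right using q0 by simp
      then have "(\<Sum>f\<in>insert g F. cip k w f * f l) = of_real q * g l + p l"
        using F(1) gF by (simp add: p_def)
      then show ?thesis using q0 True by (simp add: g_def r_def)
    next
      case False
      then have vW: "v \<in> W" using v by simp
      have "cip k v g = cip k (\<lambda>l. \<Sum>f\<in>F. cip k v f * f l) g"
        unfolding cip_def[of k _ g] using F(4) vW by (intro sum.cong) auto
      also have "\<dots> = 0" unfolding cip_sum_left using gf by (intro sum.neutral) simp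
      finally show ?thesis using F(1,4) gF vW l by simp
    qed
    moreover have "card (insert g F) \<le> card (insert w W)"
      using F(1,2) gF insert.hyps by simp
    ultimately show ?thesis using o F(1) by blast
  qed
qed

text \<open>A trace estimate. Expand each row of the isometry that lies in the span in an
  orthonormal set \<open>F\<close> and exchange the sums: every \<open>f\<close> in \<open>F\<close>
  contributes at most the squared length of the image of its conjugate under the isometry, which is
  1.\<close>

lemma sum_norm_partial_isometry_le:
  fixes u :: "nat \<Rightarrow> nat \<Rightarrow> complex"
  assumes o: "orthonormal_on m {..<k} u" and S: "S \<subseteq> {..<m}" and W: "finite W"
    and span: "\<And>i. i \<in> S \<Longrightarrow> (\<lambda>l. if l < k then u l i else 0) \<in> fun_vs.span W"
  shows "(\<Sum>i\<in>S. \<Sum>l<k. (cmod (u l i))\<^sup>2) \<le> card W"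
proof -
  obtain F where F: "finite F" "card F \<le> card W" "orthonormal_on k F (\<lambda>f. f)"
    "\<forall>w\<in>W. \<forall>l<k. w l = (\<Sum>f\<in>F. cip k w f * f l)"
    using gram_schmidt_expansion[OF W] by blast
  have exp: "\<forall>l<k. x l = (\<Sum>f\<in>F. cip k x f * f l)" if "x \<in> fun_vs.span W" for x
    using that
  proof (induction rule: fun_vs.span_induct_alt)
    case base
    show ?case by (simp add: cip_def)
  next
    case (step c w y)
    have "cip k ((\<lambda>i. c * w i) + y) f = c * cip k w f + cip k y f" for f
      by (simp add: cip_def algebra_simps sum.distrib sum_distrib_left)
    then have lin: "(\<Sum>f\<in>F. cip k ((\<lambda>i. c * w i) + y) f * f l) =
        c * (\<Sum>f\<in>F. cip k w f * f l) + (\<Sum>f\<in>F. cip k y f * f l)" for l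
      by (simp only: distrib_right sum.distrib sum_distrib_left mult.assoc)
    have wy: "w l = (\<Sum>f\<in>F. cip k w f * f l)" "y l = (\<Sum>f\<in>F. cip k y f * f l)" if "l < k" for l
      using step F(4) that by blast+
    show ?case
    proof (intro allI impI)
      fix l assume l: "l < k"
      show "((\<lambda>i. c * w i) + y) l = (\<Sum>f\<in>F. cip k ((\<lambda>i. c * w i) + y) f * f l)"
        unfolding lin wy[OF l, symmetric] by simp
    qed
  qed
  define x where "x i = (\<lambda>l. if l < k then u l i else 0)" for i
  have "(\<Sum>l<k. (cmod (u l i))\<^sup>2) = (\<Sum>f\<in>F. (cmod (cip k (x i) f))\<^sup>2)" if "i \<in> S" for i
  proof -
    have e: "x i l = (\<Sum>f\<in>F. cip k (x i) f * f l)" if "l < k" for l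
      using exp[OF span[OF \<open>i \<in> S\<close>]] that unfolding x_def by blast
    have "(\<Sum>l<k. (cmod (u l i))\<^sup>2) = (\<Sum>l<k. (cmod (x i l))\<^sup>2)" by (intro sum.cong) (auto simp: x_def)
    also have "\<dots> = (\<Sum>l<k. (cmod (\<Sum>f\<in>F. cip k (x i) f * f l))\<^sup>2)"
      using e by (intro sum.cong) auto
    also have "\<dots> = (\<Sum>f\<in>F. (cmod (cip k (x i) f))\<^sup>2)" by (rule norm_orthonormal_sum[OF F(1,3)])
    finally show ?thesis .
  qed
  then have "(\<Sum>i\<in>S. \<Sum>l<k. (cmod (u l i))\<^sup>2) = (\<Sum>f\<in>F. \<Sum>i\<in>S. (cmod (cip k (x i) f))\<^sup>2)"
    by (simp add: sum.swap[of _ F])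
  \<comment> \<open>Completing \<open>S\<close> to all rows yields the squared length of a full
    image vector, to which orthonormality of the \<open>u l\<close> applies.\<close>
  also have "\<dots> \<le> (\<Sum>f\<in>F. \<Sum>i<m. (cmod (cip k (x i) f))\<^sup>2)"
    using S by (intro sum_mono sum_mono2) auto
  also have "\<dots> = (\<Sum>f\<in>F. 1)"
  proof (rule sum.cong)
    fix f assume f: "f \<in> F"
    have "cip k (x i) f = (\<Sum>l<k. cnj (f l) * u l i)" for i
      by (auto simp: cip_def x_def mult.commute intro!: sum.cong)
    then have "(\<Sum>i<m. (cmod (cip k (x i) f))\<^sup>2) = (\<Sum>l<k. (cmod (f l))\<^sup>2)"
      using norm_orthonormal_sum[OF _ o, of "\<lambda>l. cnj (f l)"] by simp
    moreover have "cip k f f = 1" using F(3) f by (simp add: orthonormal_on_def)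
    ultimately show "(\<Sum>i<m. (cmod (cip k (x i) f))\<^sup>2) = 1"
      unfolding cip_self by (metis of_real_eq_1_iff)
  qed simp
  also have "\<dots> \<le> real (card W)" using F(2) by simp
  finally show ?thesis .
qed

text \<open>Triples of a singular value, a right vector \<open>e l\<close> and a left vector
  \<open>u l\<close>, for \<open>k\<close> of them and in no particular order. Both singular vector
  equations are recorded, so that the notion is stable under transposition.\<close>

definition partial_svd :: "nat \<Rightarrow> nat \<Rightarrow> (nat \<Rightarrow> nat \<Rightarrow> complex) \<Rightarrow> nat \<Rightarrow> (nat \<Rightarrow> real) \<Rightarrow>
    (nat \<Rightarrow> nat \<Rightarrow> complex) \<Rightarrow> (nat \<Rightarrow> nat \<Rightarrow> complex) \<Rightarrow> bool" where
  "partial_svd m n a k \<sigma> e u \<longleftrightarrow>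
    orthonormal_on n {..<k} e \<and> orthonormal_on m {..<k} u \<and>
    (\<forall>l<k. \<forall>i<m. (\<Sum>j<n. a i j * e l j) = \<sigma> l * u l i) \<and>
    (\<forall>l<k. \<forall>j<n. (\<Sum>i<m. cnj (a i j) * u l i) = \<sigma> l * e l j)"

text \<open>Conjugating the two equations exchanges the roles of the vectors for the plain
  transpose. The estimate for columns thus comes from the one for rows.\<close>

lemma partial_svd_transpose:
  assumes "partial_svd m n a k \<sigma> e u"
  shows "partial_svd n m (\<lambda>j i. a i j) k \<sigma> (\<lambda>l i. cnj (u l i)) (\<lambda>l j. cnj (e l j))"
proof -
  have "(\<Sum>i<m. a i j * cnj (u l i)) = \<sigma> l * cnj (e l j)" if "l < k" "j < n" for l j
  proof -
    have "cnj (\<Sum>i<m. cnj (a i j) * u l i) = cnj (\<sigma> l * e l j)"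
      using assms that by (simp only: partial_svd_def)
    then show ?thesis by simp
  qed
  moreover have "(\<Sum>j<n. cnj (a i j) * cnj (e l j)) = \<sigma> l * cnj (u l i)" if "l < k" "i < m" for l i
  proof -
    have "cnj (\<Sum>j<n. a i j * e l j) = cnj (\<sigma> l * u l i)"
      using assms that by (simp only: partial_svd_def)
    then show ?thesis by simp
  qed
  ultimately show ?thesis
    using assms by (simp add: partial_svd_def orthonormal_on_cnj)
qed

text \<open>The \<open>k\<close> left singular vectors have total squared mass \<open>k\<close>. At
  most \<open>card B\<close> of it sits on the rows in \<open>S\<close>, so the other rows carry at
  least \<open>k - card B\<close>, and a row of \<open>a\<close> has at least
  \<open>s\<^sup>2\<close> times the squared length of the matching row of \<open>u\<close>.\<close>

lemma row_mass_outside_span: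
  assumes svd: "partial_svd m n a k \<sigma> e u" and s: "0 < s" "\<And>l. l < k \<Longrightarrow> s \<le> \<sigma> l"
    and S: "S \<subseteq> {..<m}" and B: "finite B" and span: "\<And>i. i \<in> S \<Longrightarrow> a i \<in> fun_vs.span B"
  shows "(real k - real (card B)) * s\<^sup>2 \<le> (\<Sum>i\<in>{..<m} - S. \<Sum>j<n. (cmod (a i j))\<^sup>2)"
proof -
  have oe: "orthonormal_on n {..<k} e" and ou: "orthonormal_on m {..<k} u"
    and Ae: "\<And>l i. l < k \<Longrightarrow> i < m \<Longrightarrow> (\<Sum>j<n. a i j * e l j) = \<sigma> l * u l i"
    using svd by (simp_all add: partial_svd_def)
  \<comment> \<open>Coordinates along the right singular vectors, rescaled: \<open>T\<close> is
    linear and sends row \<open>i\<close> of \<open>a\<close> to row \<open>i\<close> of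
    \<open>u\<close>. A span of rows of \<open>a\<close> becomes a span of no more vectors.\<close>
  define T where "T v = (\<lambda>l. if l < k then (\<Sum>j<n. v j * e l j) / of_real (\<sigma> l) else 0)" for v :: "nat \<Rightarrow> complex"
  have T: "T v \<in> fun_vs.span (T ` B)" if "v \<in> fun_vs.span B" for v
    using that
  proof (induction rule: fun_vs.span_induct_alt)
    case base
    have "T 0 = 0" by (auto simp: T_def fun_eq_iff)
    then show ?case by (simp only: fun_vs.span_zero)
  next
    case (step c w y)
    have "T ((\<lambda>i. c * w i) + y) = (\<lambda>l. c * T w l) + T y"
      by (auto simp: T_def fun_eq_iff algebra_simps sum.distrib sum_distrib_left add_divide_distrib)
    moreover have "(\<lambda>l. c * T w l) + T y \<in> fun_vs.span (T ` B)"
      using step by (intro fun_vs.span_add[OF fun_vs.span_scale[OF fun_vs.span_base]]) auto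
    ultimately show ?case by (simp only:)
  qed
  have Ta: "T (a i) = (\<lambda>l. if l < k then u l i else 0)" if "i < m" for i
  proof
    fix l
    show "T (a i) l = (if l < k then u l i else 0)"
    proof (cases "l < k")
      case True
      then have "\<sigma> l \<noteq> 0" using s(1) s(2)[of l] by linarith
      then show ?thesis using True that Ae by (simp add: T_def)
    qed (simp add: T_def)
  qed
  have uS: "(\<Sum>i\<in>S. \<Sum>l<k. (cmod (u l i))\<^sup>2) \<le> card (T ` B)"
  proof (rule sum_norm_partial_isometry_le[OF ou S])
    fix i assume i: "i \<in> S"
    then have "i < m" using S by auto
    then show "(\<lambda>l. if l < k then u l i else 0) \<in> fun_vs.span (T ` B)"
      using T[OF span[OF i]] Ta by simp
  qed (use B in simp)
  also have "\<dots> \<le> real (card B)" using B card_image_le by simp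
  finally have 1: "(\<Sum>i\<in>S. \<Sum>l<k. (cmod (u l i))\<^sup>2) \<le> card B" .
  have "(\<Sum>i<m. \<Sum>l<k. (cmod (u l i))\<^sup>2) = (\<Sum>l<k. \<Sum>i<m. (cmod (u l i))\<^sup>2)"
    by (rule sum.swap)
  also have "\<dots> = (\<Sum>l<k. 1)"
  proof (rule sum.cong)
    fix l assume "l \<in> {..<k}"
    then have "cip m (u l) (u l) = 1" using ou by (simp add: orthonormal_on_def)
    then show "(\<Sum>i<m. (cmod (u l i))\<^sup>2) = 1" unfolding cip_self by (metis of_real_eq_1_iff)
  qed simp
  finally have "(\<Sum>i\<in>{..<m} - S. \<Sum>l<k. (cmod (u l i))\<^sup>2) = k - (\<Sum>i\<in>S. \<Sum>l<k. (cmod (u l i))\<^sup>2)"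
    using S by (simp add: sum_diff)
  then have "real k - real (card B) \<le> (\<Sum>i\<in>{..<m} - S. \<Sum>l<k. (cmod (u l i))\<^sup>2)" using 1 by simp
  then have "(real k - real (card B)) * s\<^sup>2 \<le> (\<Sum>i\<in>{..<m} - S. \<Sum>l<k. (cmod (u l i))\<^sup>2) * s\<^sup>2"
    by (intro mult_right_mono) auto
  also have "\<dots> \<le> (\<Sum>i\<in>{..<m} - S. \<Sum>j<n. (cmod (a i j))\<^sup>2)"
    unfolding sum_distrib_right[of _ "{..<m} - S"]
  proof (rule sum_mono)
    fix i assume i: "i \<in> {..<m} - S"
    \<comment> \<open>The coefficients of the row along the conjugated right vectors are
      \<open>\<sigma> l * u l i\<close>; Bessel's inequality bounds their squares by the length of
      the row.\<close>
    have "(\<Sum>l<k. (cmod (u l i))\<^sup>2) * s\<^sup>2 \<le> (\<Sum>l<k. (cmod (cip n (a i) (\<lambda>j. cnj (e l j))))\<^sup>2)"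
      unfolding sum_distrib_right
    proof (rule sum_mono)
      fix l assume l: "l \<in> {..<k}"
      have "cip n (a i) (\<lambda>j. cnj (e l j)) = \<sigma> l * u l i" using Ae[of l i] l i by (simp add: cip_def)
      moreover have "s\<^sup>2 \<le> (\<sigma> l)\<^sup>2" using s l by (intro power_mono) auto
      ultimately show "(cmod (u l i))\<^sup>2 * s\<^sup>2 \<le> (cmod (cip n (a i) (\<lambda>j. cnj (e l j))))\<^sup>2"
        by (simp add: norm_mult power_mult_distrib mult.commute[of _ "s\<^sup>2"] mult_right_mono)
    qed
    also have "\<dots> \<le> (\<Sum>j<n. (cmod (a i j))\<^sup>2)"
      by (rule bessel_inequality) (use orthonormal_on_cnj[OF oe] in auto)
    finally show "(\<Sum>l<k. (cmod (u l i))\<^sup>2) * s\<^sup>2 \<le> (\<Sum>j<n. (cmod (a i j))\<^sup>2)" .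
  qed
  finally show ?thesis .
qed

section \<open>Singular values\<close>

definition real_diag_mat :: "real list \<Rightarrow> complex mat" where
  "real_diag_mat ds = mat (length ds) (length ds) (\<lambda>(i, j). if i = j then of_real (ds ! i) else 0)"

text \<open>The vectors returned by \<open>gram_schmidt\<close> are orthogonal but of arbitrary
  length; dividing by \<open>N j\<close> makes the matrix unitary and keeps the first column on the
  line of \<open>v\<close>.\<close>

lemma unitary_with_first_column:
  fixes v :: "complex vec"
  assumes v: "v \<in> carrier_vec n" "v \<noteq> 0\<^sub>v n" and n: "n > 0"
  obtains W c where "W \<in> carrier_mat n n" "mat_adjoint W * W = 1\<^sub>m n" "col W 0 = c \<cdot>\<^sub>v v"
proof -
  define b where "b = basis_completion v"
  define ws where "ws = gram_schmidt n b"
  interpret cof_vec_space n "TYPE(complex)" .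
  from basis_completion[OF v, folded b_def]
  have dist_b: "distinct b" and indep: "\<not> lin_dep (set b)" and b: "set b \<subseteq> carrier_vec n"
    and hdb: "hd b = v" and len_b: "length b = n" by auto
  from hdb len_b n obtain vs where bv: "b = v # vs" by (cases b) auto
  from gram_schmidt_result[OF b dist_b indep refl, folded ws_def]
  have ws: "set ws \<subseteq> carrier_vec n" "corthogonal ws" "length ws = n"
    by (auto simp: len_b)
  from gram_schmidt_hd[OF v(1), of vs, folded bv] have hdws: "hd ws = v" unfolding ws_def .
  then have ws0: "ws ! 0 = v" using ws n by (metis hd_conv_nth length_0_conv less_irrefl)
  have wsc: "ws ! j \<in> carrier_vec n" if "j < n" for j using ws that nth_mem by blast
  define N where "N j = sqrt (\<Sum>i<n. (cmod (ws ! j $ i))\<^sup>2)" for j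
  define W where "W = mat n n (\<lambda>(i, j). ws ! j $ i / of_real (N j))"
  have W: "W \<in> carrier_mat n n" by (simp add: W_def)
  have ip: "ws ! j \<bullet>c ws ! l = (\<Sum>i<n. ws ! j $ i * cnj (ws ! l $ i))" if "j < n" "l < n" for j l
    using wsc[OF that(1)] wsc[OF that(2)] by (simp add: scalar_prod_def atLeast0LessThan)
  have orth: "(\<Sum>i<n. ws ! j $ i * cnj (ws ! l $ i)) = 0" if "j < n" "l < n" "j \<noteq> l" for j l
    using corthogonalD[OF ws(2), of j l] ws(3) that ip by simp
  have N2: "of_real (N j) * of_real (N j) = (\<Sum>i<n. ws ! j $ i * cnj (ws ! j $ i))" for j
  proof -
    have "of_real (N j) * of_real (N j) = complex_of_real ((N j)\<^sup>2)" by (simp add: power2_eq_square)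
    also have "\<dots> = complex_of_real (\<Sum>i<n. (cmod (ws ! j $ i))\<^sup>2)"
      unfolding N_def by (subst real_sqrt_pow2) (auto intro: sum_nonneg)
    also have "\<dots> = (\<Sum>i<n. ws ! j $ i * cnj (ws ! j $ i))" by (simp only: of_real_sum complex_norm_square)
    finally show ?thesis .
  qed
  have N0: "N j \<noteq> 0" if "j < n" for j
    using corthogonalD[OF ws(2), of j j] ws(3) that ip[of j j] N2[of j] by auto
  have "mat_adjoint W * W = 1\<^sub>m n"
  proof (rule eq_matI)
    fix l j assume "l < dim_row (1\<^sub>m n :: complex mat)" "j < dim_col (1\<^sub>m n :: complex mat)"
    then have lj: "l < n" "j < n" by auto
    have "(mat_adjoint W * W) $$ (l, j) = (\<Sum>i<n. (ws ! j $ i * cnj (ws ! l $ i)) / (of_real (N l) * of_real (N j)))"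
      unfolding mult_index_sum[OF mat_adjoint_carrier[OF W] W lj]
      using W lj by (intro sum.cong) (auto simp: W_def)
    also have "\<dots> = (\<Sum>i<n. ws ! j $ i * cnj (ws ! l $ i)) / (of_real (N l) * of_real (N j))"
      by (rule sum_divide_distrib[symmetric])
    also have "\<dots> = (if l = j then 1 else 0)"
    proof (cases "l = j")
      case True
      then show ?thesis using N0[OF lj(2)] by (simp add: N2[of j, symmetric])
    next
      case False
      then show ?thesis using orth[of j l] lj by simp
    qed
    finally show "(mat_adjoint W * W) $$ (l, j) = 1\<^sub>m n $$ (l, j)" using lj by simp
  qed (use W in auto)
  moreover have "col W 0 = (1 / of_real (N 0)) \<cdot>\<^sub>v v"
    using n ws0 v(1) by (intro eq_vecI) (auto simp: W_def)
  ultimately show ?thesis using that W by blast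
qed

lemma col_mult_mat_vec:
  assumes "H \<in> carrier_mat n n" "W \<in> carrier_mat n p" "j < p"
  shows "col (H * W) j = H *\<^sub>v col W j"
  using assms by (intro eq_vecI) auto

text \<open>Deflation: in a unitary basis that starts with an eigenvector, the first column is a
  multiple of the first unit vector. By self-adjointness so is the first row, and the remaining
  block is Hermitian of smaller size.\<close>

theorem hermitian_unitary_diagonalization:
  fixes H :: "complex mat"
  assumes "H \<in> carrier_mat n n" "mat_adjoint H = H"
  shows "\<exists>P ds. P \<in> carrier_mat n n \<and> length ds = n \<and> mat_adjoint P * P = 1\<^sub>m n \<and>
    H * P = P * real_diag_mat ds"
  using assms
proof (induction n arbitrary: H)
  case 0
  then show ?case
    by (intro exI[of _ "1\<^sub>m 0"] exI[of _ "[]"]) (auto simp: real_diag_mat_def)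
next
  case (Suc n)
  note H = Suc.prems(1)
  have "\<exists>e. poly (char_poly H) e = 0"
  proof (rule fundamental_theorem_of_algebra)
    show "\<not> constant (poly (char_poly H))"
      using degree_monic_char_poly[OF H] by (simp add: constant_degree)
  qed
  then obtain e where "eigenvalue H e" using eigenvalue_root_char_poly[OF H] by blast
  then obtain v where v: "v \<in> carrier_vec (Suc n)" "v \<noteq> 0\<^sub>v (Suc n)" "H *\<^sub>v v = e \<cdot>\<^sub>v v"
    using H by (auto simp: eigenvalue_def eigenvector_def)
  obtain W c where W: "W \<in> carrier_mat (Suc n) (Suc n)" "mat_adjoint W * W = 1\<^sub>m (Suc n)" "col W 0 = c \<cdot>\<^sub>v v"
    using unitary_with_first_column[OF v(1,2)] by blast
  define W' where "W' = mat_adjoint W"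
  have W': "W' \<in> carrier_mat (Suc n) (Suc n)" "W' * W = 1\<^sub>m (Suc n)" using W by (simp_all add: W'_def)
  have WW': "W * W' = 1\<^sub>m (Suc n)" using mat_mult_left_right_inverse[OF W'(1) W(1) W'(2)] .
  define H' where "H' = W' * (H * W)"
  have HW: "H * W \<in> carrier_mat (Suc n) (Suc n)" using H W by simp
  have H': "H' \<in> carrier_mat (Suc n) (Suc n)" using W' HW by (simp add: H'_def)
  have H'adj: "mat_adjoint H' = H'"
  proof -
    have "mat_adjoint H' = mat_adjoint (H * W) * W"
      unfolding H'_def mat_adjoint_mult[OF W'(1) HW] by (simp add: W'_def)
    also have "\<dots> = W' * H * W" unfolding mat_adjoint_mult[OF H W(1)] Suc.prems(2) W'_def ..
    also have "\<dots> = H'" unfolding H'_def by (rule assoc_mult_mat[OF W'(1) H W(1)])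
    finally show ?thesis .
  qed
  have H'sym: "H' $$ (j, i) = cnj (H' $$ (i, j))" if "i < Suc n" "j < Suc n" for i j
  proof -
    have "mat_adjoint H' $$ (j, i) = conjugate (H' $$ (i, j))" using that H' by (intro mat_adjoint_index) auto
    then show ?thesis unfolding H'adj by simp
  qed
  have col0: "H' $$ (i, 0) = (if i = 0 then e else 0)" if i: "i < Suc n" for i
  proof -
    have "col (H * W) 0 = e \<cdot>\<^sub>v col W 0"
      unfolding col_mult_mat_vec[OF H W(1) zero_less_Suc] W(3)
      using v H by (simp add: mult_mat_vec smult_smult_assoc mult.commute)
    then have hw: "(H * W) $$ (l, 0) = e * W $$ (l, 0)" if "l < Suc n" for l
      using that H W by (metis (no_types, lifting) HW carrier_matD(1,2) dim_col index_col index_smult_vec(1) zero_less_Suc)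
    have "H' $$ (i, 0) = (\<Sum>l<Suc n. W' $$ (i, l) * (H * W) $$ (l, 0))"
      unfolding H'_def by (rule mult_index_sum[OF W'(1) HW i]) simp
    also have "\<dots> = (\<Sum>l<Suc n. e * (W' $$ (i, l) * W $$ (l, 0)))" using hw by (intro sum.cong) auto
    also have "\<dots> = e * (W' * W) $$ (i, 0)"
      unfolding sum_distrib_left[symmetric] by (subst mult_index_sum[OF W'(1) W(1) i]) auto
    finally show ?thesis using i by (simp add: W'(2))
  qed
  \<comment> \<open>The eigenvalue is a diagonal entry of a self-adjoint matrix, hence real.\<close>
  have e: "e = of_real (Re e)"
  proof -
    have "e = cnj e" using H'sym[of 0 0] col0[of 0] by simp
    then show ?thesis by (metis Reals_cnj_iff complex_is_Real_iff of_real_Re)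
  qed
  have row0: "H' $$ (0, j) = (if j = 0 then e else 0)" if "j < Suc n" for j
    using H'sym[of j 0] col0[of j] that e by (metis complex_cnj_zero complex_cnj_complex_of_real zero_less_Suc)
  define H3 where "H3 = mat n n (\<lambda>(i, j). H' $$ (Suc i, Suc j))"
  have H3: "H3 \<in> carrier_mat n n" by (simp add: H3_def)
  have "mat_adjoint H3 = H3"
  proof (rule eq_matI)
    fix i j assume "i < dim_row H3" "j < dim_col H3"
    then have ij: "i < n" "j < n" by (simp_all add: H3_def)
    then have "mat_adjoint H3 $$ (i, j) = cnj (H' $$ (Suc j, Suc i))" by (simp add: H3_def)
    also have "\<dots> = H' $$ (Suc i, Suc j)" using H'sym[of "Suc j" "Suc i"] ij by simp
    finally show "mat_adjoint H3 $$ (i, j) = H3 $$ (i, j)" using ij by (simp add: H3_def)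
  qed (simp_all add: H3_def)
  from Suc.IH[OF H3 this] obtain P3 ds where P3: "P3 \<in> carrier_mat n n" "length ds = n"
    "mat_adjoint P3 * P3 = 1\<^sub>m n" "H3 * P3 = P3 * real_diag_mat ds" by blast
  let ?z = "0\<^sub>m 1 n :: complex mat" and ?z' = "0\<^sub>m n 1 :: complex mat"
  define E1 where "E1 = mat 1 1 (\<lambda>_. e)"
  define Q where "Q = four_block_mat (1\<^sub>m 1) ?z ?z' P3"
  define Q' where "Q' = four_block_mat (1\<^sub>m 1) ?z ?z' (mat_adjoint P3)"
  have D: "real_diag_mat ds \<in> carrier_mat n n" using P3 by (simp add: real_diag_mat_def)
  have E1: "E1 \<in> carrier_mat 1 1" by (simp add: E1_def)
  have Q: "Q \<in> carrier_mat (Suc n) (Suc n)" and Q': "Q' \<in> carrier_mat (Suc n) (Suc n)"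
    using four_block_carrier_mat[OF one_carrier_mat[of 1] P3(1), of ?z ?z']
      four_block_carrier_mat[OF one_carrier_mat[of 1] mat_adjoint_carrier[OF P3(1)], of ?z ?z']
    by (simp_all add: Q_def Q'_def)
  have Q'Q: "Q' * Q = 1\<^sub>m (Suc n)"
    unfolding Q'_def Q_def
    by (subst mult_four_block_mat[of _ 1 1 _ n _ n _ _ 1 _ n]) (use P3 in auto)
  have Q'adj: "mat_adjoint Q = Q'"
    using P3 by (intro eq_matI) (auto simp: Q_def Q'_def)
  have H'block: "H' = four_block_mat E1 ?z ?z' H3"
    using H' col0 row0 by (intro eq_matI) (auto simp: E1_def H3_def)
  have Dblock: "real_diag_mat (Re e # ds) = four_block_mat E1 ?z ?z' (real_diag_mat ds)"
    using P3(2) e by (intro eq_matI) (auto simp: E1_def real_diag_mat_def nth_Cons')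
  have HQ: "H' * Q = Q * real_diag_mat (Re e # ds)"
  proof -
    have "H' * Q = four_block_mat E1 ?z ?z' (H3 * P3)"
      unfolding H'block Q_def
      by (subst mult_four_block_mat[of _ 1 1 _ n _ n _ _ 1 _ n]) (use P3(1) H3 E1 in auto)
    moreover have "Q * real_diag_mat (Re e # ds) = four_block_mat E1 ?z ?z' (P3 * real_diag_mat ds)"
      unfolding Dblock Q_def
      by (subst mult_four_block_mat[of _ 1 1 _ n _ n _ _ 1 _ n]) (use P3(1) D E1 in auto)
    ultimately show ?thesis using P3(4) by simp
  qed
  define P where "P = W * Q"
  define D1 where "D1 = real_diag_mat (Re e # ds)"
  have D1: "D1 \<in> carrier_mat (Suc n) (Suc n)" using P3(2) by (simp add: D1_def real_diag_mat_def)
  have P: "P \<in> carrier_mat (Suc n) (Suc n)" using W Q by (simp add: P_def)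
  have PP: "mat_adjoint P * P = 1\<^sub>m (Suc n)"
  proof -
    have "mat_adjoint P * P = (Q' * W') * (W * Q)"
      unfolding P_def mat_adjoint_mult[OF W(1) Q] Q'adj W'_def ..
    also have "\<dots> = Q' * (W' * (W * Q))" using Q' W' W Q by (intro assoc_mult_mat) auto
    also have "W' * (W * Q) = (W' * W) * Q" by (rule assoc_mult_mat[OF W'(1) W(1) Q, symmetric])
    finally show ?thesis unfolding W'(2) left_mult_one_mat[OF Q] Q'Q .
  qed
  have HP: "H * P = P * D1"
  proof -
    have "H * P = (W * W') * (H * P)"
      unfolding WW' using H P by (metis left_mult_one_mat mult_carrier_mat)
    also have "\<dots> = W * (W' * (H * P))" using W W' H P by (intro assoc_mult_mat) auto
    also have "W' * (H * P) = Q * D1"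
    proof -
      have "H * P = (H * W) * Q" unfolding P_def by (rule assoc_mult_mat[OF H W(1) Q, symmetric])
      then have "W' * (H * P) = W' * (H * W * Q)" by simp
      also have "\<dots> = H' * Q" unfolding H'_def by (rule assoc_mult_mat[OF W'(1) HW Q, symmetric])
      finally show ?thesis unfolding HQ D1_def .
    qed
    also have "W * (Q * D1) = P * D1" unfolding P_def by (rule assoc_mult_mat[OF W(1) Q D1, symmetric])
    finally show ?thesis .
  qed
  show ?case using P PP HP P3(2) unfolding D1_def
    by (intro exI[of _ P] exI[of _ "Re e # ds"]) simp
qed

section \<open>Singular values and singular vectors\<close>

lemma char_poly_unitary_diagonalization:
  assumes H: "H \<in> carrier_mat n n" and P: "P \<in> carrier_mat n n" "length ds = n"
    "mat_adjoint P * P = 1\<^sub>m n" "H * P = P * real_diag_mat ds"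
  shows "char_poly H = (\<Prod>a\<leftarrow>map complex_of_real ds. [:- a, 1:])"
proof -
  let ?D = "real_diag_mat ds"
  have D: "?D \<in> carrier_mat n n" using P(2) by (simp add: real_diag_mat_def)
  have P': "mat_adjoint P \<in> carrier_mat n n" using P(1) by simp
  have PP': "P * mat_adjoint P = 1\<^sub>m n" using mat_mult_left_right_inverse[OF P' P(1,3)] .
  have "P * ?D * mat_adjoint P = H * P * mat_adjoint P" using P(4) by simp
  also have "\<dots> = H * (P * mat_adjoint P)" by (rule assoc_mult_mat[OF H P(1) P'])
  also have "\<dots> = H" unfolding PP' using H by simp
  finally have HD: "P * ?D * mat_adjoint P = H" .
  have "similar_mat_wit H ?D P (mat_adjoint P)"
    by (rule similar_mat_witI[OF PP' P(3) HD[symmetric] H D P(1) P'])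
  then have "similar_mat H ?D" unfolding similar_mat_def by blast
  then have "char_poly H = char_poly ?D" by (rule char_poly_similar)
  also have "\<dots> = (\<Prod>a\<leftarrow>diag_mat ?D. [:- a, 1:])"
    by (rule char_poly_upper_triangular[OF D]) (auto simp: real_diag_mat_def)
  also have "diag_mat ?D = map complex_of_real ds"
    by (rule nth_equalityI) (auto simp: diag_mat_def real_diag_mat_def)
  finally show ?thesis .
qed

lemma proots_prod_linear_factors: "proots (\<Prod>a\<leftarrow>es. [:- a, 1:]) = mset es"
proof (induction es)
  case (Cons e es)
  have "(\<Prod>a\<leftarrow>es. [:- a, 1:]) \<noteq> 0" by (auto simp: prod_list_zero_iff)
  then have "proots ([:- e, 1:] * (\<Prod>a\<leftarrow>es. [:- a, 1:])) = {#e#} + mset es"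
    using proots_linear_factor[of "- e"] Cons by (subst proots_mult) auto
  then show ?case by (simp only: list.map prod_list.Cons mset.simps union_mset_add_mset_left add_0)
qed simp

lemma singular_values_eq:
  assumes "char_poly (mat_adjoint A * A) = (\<Prod>a\<leftarrow>es. [:- a, 1:])"
  shows "singular_values A = rev (sort (map (\<lambda>a. sqrt (norm a)) es))"
  unfolding singular_values_def assms proots_prod_linear_factors mset_map[symmetric]
  by (simp only: sorted_list_of_multiset_mset)

lemma map_poly_of_real_prod_linear:
  "map_poly complex_of_real (\<Prod>a\<leftarrow>ds. [:- a, 1:]) = (\<Prod>a\<leftarrow>map complex_of_real ds. [:- a, 1:])"
proof (induction ds)
  case (Cons d ds)
  have hom: "map_poly complex_of_real (p * q) = map_poly complex_of_real p * map_poly complex_of_real q" for p q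
    by (intro poly_eqI) (simp add: coeff_map_poly coeff_mult)
  have lin: "map_poly complex_of_real [:- d, 1:] = [:- of_real d, 1:]" by (simp add: map_poly_pCons)
  show ?case by (simp only: list.map prod_list.Cons hom lin Cons)
qed auto

text \<open>For a real matrix the characteristic polynomial is formed over the reals, where it might
  fail to split. Its complexification splits with real roots because the Gram matrix is Hermitian,
  and embedding coefficients is injective, so the factorization descends.\<close>

lemma singular_values_map_of_real:
  fixes A :: "real mat"
  shows "singular_values (map_mat complex_of_real A) = singular_values A"
proof -
  define m n where "m = dim_row A" and "n = dim_col A"
  have A: "A \<in> carrier_mat m n" by (auto simp: m_def n_def)
  let ?A = "map_mat complex_of_real A"
  have cA: "?A \<in> carrier_mat m n" using A by simp
  have G: "mat_adjoint A * A \<in> carrier_mat n n" using A by (auto intro!: mult_carrier_mat)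
  have cG: "mat_adjoint ?A * ?A \<in> carrier_mat n n" using cA by (auto intro!: mult_carrier_mat)
  have Gmap: "mat_adjoint ?A * ?A = map_mat complex_of_real (mat_adjoint A * A)"
  proof (rule eq_matI)
    fix i j assume "i < dim_row (map_mat complex_of_real (mat_adjoint A * A))"
      "j < dim_col (map_mat complex_of_real (mat_adjoint A * A))"
    then have ij: "i < n" "j < n" using A by auto
    have "(mat_adjoint ?A * ?A) $$ (i, j) = (\<Sum>l<m. of_real (A $$ (l, i) * A $$ (l, j)))"
      unfolding mult_index_sum[OF mat_adjoint_carrier[OF cA] cA ij]
      using A ij by (intro sum.cong) auto
    also have "\<dots> = of_real ((mat_adjoint A * A) $$ (i, j))"
      unfolding mult_index_sum[OF mat_adjoint_carrier[OF A] A ij] of_real_sum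
      using A ij by (intro sum.cong) auto
    finally show "(mat_adjoint ?A * ?A) $$ (i, j) = map_mat complex_of_real (mat_adjoint A * A) $$ (i, j)"
      using ij A by simp
  qed (use A in auto)
  have "mat_adjoint (mat_adjoint ?A * ?A) = mat_adjoint ?A * ?A"
    using mat_adjoint_mult[OF mat_adjoint_carrier[OF cA] cA] by simp
  from hermitian_unitary_diagonalization[OF cG this]
  obtain P ds where P: "P \<in> carrier_mat n n" "length ds = n" "mat_adjoint P * P = 1\<^sub>m n"
    "mat_adjoint ?A * ?A * P = P * real_diag_mat ds" by blast
  have c1: "char_poly (mat_adjoint ?A * ?A) = (\<Prod>a\<leftarrow>map complex_of_real ds. [:- a, 1:])"
    by (rule char_poly_unitary_diagonalization[OF cG P])
  have "map_poly complex_of_real (char_poly (mat_adjoint A * A)) = map_poly complex_of_real (\<Prod>a\<leftarrow>ds. [:- a, 1:])"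
    using c1 unfolding Gmap of_real_hom.char_poly_hom[OF G] map_poly_of_real_prod_linear .
  then have c2: "char_poly (mat_adjoint A * A) = (\<Prod>a\<leftarrow>ds. [:- a, 1:])"
    by (auto simp: poly_eq_iff coeff_map_poly)
  show ?thesis
    unfolding singular_values_eq[OF c1] singular_values_eq[OF c2] by (simp add: o_def)
qed

text \<open>Sorting forgets which eigenvector belongs to which eigenvalue. The injection
  \<open>f\<close> recovers \<open>k\<close> different positions in the unsorted list that hold the
  \<open>k\<close> largest values.\<close>

lemma rev_sort_nth_witnesses:
  fixes xs :: "real list"
  assumes k: "1 \<le> k" "k \<le> length xs"
  obtains f where "inj_on f {..<k}" "\<And>l. l < k \<Longrightarrow> f l < length xs"
    "\<And>l. l < k \<Longrightarrow> rev (sort xs) ! (k - 1) \<le> xs ! f l"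
proof -
  let ?L = "rev (sort xs)"
  have "mset ?L = mset xs" by simp
  then obtain f where f: "f permutes {..<length xs}" "permute_list f xs = ?L"
    by (rule mset_eq_permutation)
  have L: "?L ! l = xs ! f l" if "l < length xs" for l
    using permute_list_nth[OF f(1) that] f(2) by simp
  have le: "?L ! (k - 1) \<le> ?L ! l" if "l < k" for l
  proof -
    have "sort xs ! (length xs - Suc (k - 1)) \<le> sort xs ! (length xs - Suc l)"
      using that k by (intro sorted_nth_mono) auto
    then show ?thesis using that k by (simp add: rev_nth)
  qed
  have "?L ! (k - 1) \<le> xs ! f l" if "l < k" for l using le[OF that] L[of l] that k by simp
  moreover have "inj_on f {..<k}" using permutes_inj[OF f(1)] inj_on_subset by blast
  moreover have "f l < length xs" if "l < k" for l
    using permutes_in_image[OF f(1), of l] that k by simp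
  ultimately show ?thesis using that by blast
qed

lemma singular_values_diagonalization:
  fixes A :: "complex mat"
  assumes A: "A \<in> carrier_mat m n"
  obtains ds where "length ds = n" "singular_values A = rev (sort (map (\<lambda>d. sqrt \<bar>d\<bar>) ds))"
    "\<exists>P. P \<in> carrier_mat n n \<and> mat_adjoint P * P = 1\<^sub>m n \<and> mat_adjoint A * A * P = P * real_diag_mat ds"
proof -
  let ?H = "mat_adjoint A * A"
  have A': "mat_adjoint A \<in> carrier_mat n m" using A by simp
  have H: "?H \<in> carrier_mat n n" using A by (auto intro!: mult_carrier_mat)
  have "mat_adjoint ?H = ?H" using mat_adjoint_mult[OF A' A] by simp
  from hermitian_unitary_diagonalization[OF H this]
  obtain P ds where P: "P \<in> carrier_mat n n" "length ds = n" "mat_adjoint P * P = 1\<^sub>m n"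
    "?H * P = P * real_diag_mat ds" by blast
  have "char_poly ?H = (\<Prod>a\<leftarrow>map complex_of_real ds. [:- a, 1:])"
    by (rule char_poly_unitary_diagonalization[OF H P])
  from singular_values_eq[OF this]
  have sv: "singular_values A = rev (sort (map (\<lambda>d. sqrt \<bar>d\<bar>) ds))" by (simp add: o_def)
  show ?thesis using that[OF P(2) sv] P by blast
qed

text \<open>The bounds on \<open>k\<close> keep the index inside the list, so that \<open>!\<close>
  returns an actual entry, which is a square root of an absolute value.\<close>

lemma sing_val_nonneg:
  fixes A :: "complex mat"
  assumes A: "A \<in> carrier_mat m n" and k: "1 \<le> k" "k \<le> n"
  shows "0 \<le> sing_val A k"
proof -
  obtain ds where ds: "length ds = n" "singular_values A = rev (sort (map (\<lambda>d. sqrt \<bar>d\<bar>) ds))"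
    using singular_values_diagonalization[OF A] by blast
  have "singular_values A ! (k - 1) \<in> set (singular_values A)"
    using ds k by (intro nth_mem) simp
  then show ?thesis unfolding sing_val_def using ds by auto
qed

text \<open>The right vectors are eigenvectors of the Gram matrix whose singular value is at least
  \<open>s\<close>; applying \<open>A\<close> and dividing by the singular value gives the left
  ones. Positivity of \<open>s\<close> makes the division legitimate.\<close>

lemma partial_svd_exists:
  fixes A :: "complex mat"
  assumes A: "A \<in> carrier_mat m n" and k: "1 \<le> k" "k \<le> n" and s: "sing_val A k = s" "s > 0"
  obtains \<sigma> e u where "partial_svd m n (row_fun A) k \<sigma> e u" "\<And>l. l < k \<Longrightarrow> s \<le> \<sigma> l"
proof -
  let ?H = "mat_adjoint A * A"
  have A': "mat_adjoint A \<in> carrier_mat n m" using A by simp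
  obtain ds P where ds: "length ds = n" and sv: "singular_values A = rev (sort (map (\<lambda>d. sqrt \<bar>d\<bar>) ds))"
    and P': "P \<in> carrier_mat n n" "mat_adjoint P * P = 1\<^sub>m n" "?H * P = P * real_diag_mat ds"
    using singular_values_diagonalization[OF A] by blast
  note P = P'(1) ds P'(2,3)
  obtain f where f: "inj_on f {..<k}" "\<And>l. l < k \<Longrightarrow> f l < n" "\<And>l. l < k \<Longrightarrow> s \<le> sqrt \<bar>ds ! f l\<bar>"
  proof (rule rev_sort_nth_witnesses[of k "map (\<lambda>d. sqrt \<bar>d\<bar>) ds"])
    fix f assume "inj_on f {..<k}" "\<And>l. l < k \<Longrightarrow> f l < length (map (\<lambda>d. sqrt \<bar>d\<bar>) ds)"
      "\<And>l. l < k \<Longrightarrow> rev (sort (map (\<lambda>d. sqrt \<bar>d\<bar>) ds)) ! (k - 1) \<le> map (\<lambda>d. sqrt \<bar>d\<bar>) ds ! f l"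
    then show thesis using that[of f] P(2) s(1) by (simp add: sing_val_def sv)
  qed (use k P in auto)
  \<comment> \<open>The columns of \<open>G\<close> are orthogonal with squared lengths
    \<open>ds\<close>.\<close>
  define G where "G = A * P"
  have G: "G \<in> carrier_mat m n" using A P by (simp add: G_def)
  have D: "real_diag_mat ds \<in> carrier_mat n n" using P(2) by (simp add: real_diag_mat_def)
  have P': "mat_adjoint P \<in> carrier_mat n n" using P by simp
  have AG: "mat_adjoint A * G = P * real_diag_mat ds"
    unfolding G_def P(4)[symmetric] by (rule assoc_mult_mat[OF A' A P(1), symmetric])
  have GG: "mat_adjoint G * G = real_diag_mat ds"
  proof -
    have "mat_adjoint G * G = mat_adjoint P * mat_adjoint A * G"
      unfolding G_def mat_adjoint_mult[OF A P(1)] ..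
    also have "\<dots> = mat_adjoint P * (mat_adjoint A * G)" by (rule assoc_mult_mat[OF P' A' G])
    also have "\<dots> = (mat_adjoint P * P) * real_diag_mat ds"
      unfolding AG by (rule assoc_mult_mat[OF P' P(1) D, symmetric])
    finally show ?thesis unfolding P(3) left_mult_one_mat[OF D] .
  qed
  have GGi: "(\<Sum>i<m. cnj (G $$ (i, a)) * G $$ (i, b)) = (if a = b then of_real (ds ! a) else 0)"
    if "a < n" "b < n" for a b
  proof -
    have "(\<Sum>i<m. cnj (G $$ (i, a)) * G $$ (i, b)) = (mat_adjoint G * G) $$ (a, b)"
      unfolding mult_index_sum[OF mat_adjoint_carrier[OF G] G that] using G that by (intro sum.cong) auto
    then show ?thesis unfolding GG using that P(2) by (simp add: real_diag_mat_def)
  qed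
  have PPi: "(\<Sum>i<n. cnj (P $$ (i, a)) * P $$ (i, b)) = (if a = b then 1 else 0)"
    if "a < n" "b < n" for a b
  proof -
    have "(\<Sum>i<n. cnj (P $$ (i, a)) * P $$ (i, b)) = (mat_adjoint P * P) $$ (a, b)"
      unfolding mult_index_sum[OF P' P(1) that] using P(1) that by (intro sum.cong) auto
    then show ?thesis unfolding P(3) using that by simp
  qed
  have AGi: "(\<Sum>i<m. cnj (A $$ (i, j)) * G $$ (i, b)) = P $$ (j, b) * of_real (ds ! b)"
    if "j < n" "b < n" for j b
  proof -
    have "(\<Sum>i<m. cnj (A $$ (i, j)) * G $$ (i, b)) = (mat_adjoint A * G) $$ (j, b)"
      unfolding mult_index_sum[OF A' G that] using A that by (intro sum.cong) auto
    also have "\<dots> = (\<Sum>l<n. if l = b then P $$ (j, l) * of_real (ds ! l) else 0)"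
      unfolding AG mult_index_sum[OF P(1) D that] using P(2) that
      by (intro sum.cong) (auto simp: real_diag_mat_def)
    finally show ?thesis using that by simp
  qed
  have dnn: "ds ! a \<ge> 0" if "a < n" for a
  proof -
    have "complex_of_real (ds ! a) = (\<Sum>i<m. G $$ (i, a) * cnj (G $$ (i, a)))"
      using GGi[OF that that] by (simp add: mult.commute)
    also have "\<dots> = complex_of_real (\<Sum>i<m. (cmod (G $$ (i, a)))\<^sup>2)"
      by (simp only: of_real_sum complex_norm_square)
    finally have "ds ! a = (\<Sum>i<m. (cmod (G $$ (i, a)))\<^sup>2)" by (simp only: of_real_eq_iff)
    then show ?thesis by (simp add: sum_nonneg)
  qed
  define \<sigma> where "\<sigma> l = sqrt (ds ! f l)" for l
  define e where "e l j = P $$ (j, f l)" for l j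
  define u where "u l i = G $$ (i, f l) / of_real (\<sigma> l)" for l i
  have \<sigma>: "s \<le> \<sigma> l" if "l < k" for l using f(2,3)[OF that] dnn by (simp add: \<sigma>_def)
  then have \<sigma>0: "\<sigma> l \<noteq> 0" if "l < k" for l using s(2) that by fastforce
  have \<sigma>2: "complex_of_real (\<sigma> l) * of_real (\<sigma> l) = of_real (ds ! f l)" if "l < k" for l
    using dnn[OF f(2)[OF that]] by (simp add: \<sigma>_def flip: of_real_mult)
  have "partial_svd m n (row_fun A) k \<sigma> e u"
    unfolding partial_svd_def
  proof (intro conjI allI impI)
    show "orthonormal_on n {..<k} e"
      unfolding orthonormal_on_def
    proof (intro ballI)
      fix l l' assume "l \<in> {..<k}" "l' \<in> {..<k}"
      then have ll: "l < k" "l' < k" by auto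
      have "cip n (e l) (e l') = (if f l' = f l then 1 else 0)"
        unfolding PPi[OF f(2)[OF ll(2)] f(2)[OF ll(1)], symmetric] cip_def e_def
        by (simp add: mult.commute)
      then show "cip n (e l) (e l') = (if l = l' then 1 else 0)"
        using inj_on_eq_iff[OF f(1), of l l'] ll by auto
    qed
    show "orthonormal_on m {..<k} u"
      unfolding orthonormal_on_def
    proof (intro ballI)
      fix l l' assume "l \<in> {..<k}" "l' \<in> {..<k}"
      then have ll: "l < k" "l' < k" by auto
      have "cip m (u l) (u l') = (\<Sum>i<m. cnj (G $$ (i, f l')) * G $$ (i, f l)) / (of_real (\<sigma> l') * of_real (\<sigma> l))"
        unfolding cip_def u_def sum_divide_distrib by (intro sum.cong) (auto simp: mult.commute)
      also have "\<dots> = (if f l' = f l then of_real (ds ! f l') else 0) / (of_real (\<sigma> l') * of_real (\<sigma> l))"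
        unfolding GGi[OF f(2)[OF ll(2)] f(2)[OF ll(1)]] ..
      also have "\<dots> = (if l = l' then 1 else 0)"
      proof (cases "l = l'")
        case True
        then show ?thesis using \<sigma>0[OF ll(1)] by (simp add: \<sigma>2[OF ll(2), symmetric])
      next
        case False
        then have "f l' \<noteq> f l" using inj_on_eq_iff[OF f(1), of l l'] ll by auto
        then show ?thesis using False by simp
      qed
      finally show "cip m (u l) (u l') = (if l = l' then 1 else 0)" .
    qed
  next
    fix l i assume l: "l < k" and i: "i < m"
    have "(\<Sum>j<n. row_fun A i j * e l j) = G $$ (i, f l)"
      unfolding G_def mult_index_sum[OF A P(1) i f(2)[OF l]] e_def
      using A i by (intro sum.cong) (auto simp: row_fun_def)
    then show "(\<Sum>j<n. row_fun A i j * e l j) = \<sigma> l * u l i" using \<sigma>0[OF l] by (simp add: u_def)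
  next
    fix l j assume l: "l < k" and j: "j < n"
    have "(\<Sum>i<m. cnj (row_fun A i j) * u l i) = (\<Sum>i<m. cnj (A $$ (i, j)) * G $$ (i, f l)) / of_real (\<sigma> l)"
      unfolding u_def sum_divide_distrib using A j by (intro sum.cong) (auto simp: row_fun_def)
    also have "\<dots> = P $$ (j, f l) * (of_real (\<sigma> l) * of_real (\<sigma> l)) / of_real (\<sigma> l)"
      unfolding AGi[OF j f(2)[OF l]] \<sigma>2[OF l] ..
    also have "\<dots> = \<sigma> l * e l j" using \<sigma>0[OF l] by (simp add: e_def)
    finally show "(\<Sum>i<m. cnj (row_fun A i j) * u l i) = \<sigma> l * e l j" .
  qed
  then show ?thesis using that \<sigma> by blast
qed

section \<open>Random sampling\<close>

lemma expectation_finite_sum: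
  fixes f :: "'b \<Rightarrow> real"
  assumes "finite A" "set_pmf p \<subseteq> A"
  shows "measure_pmf.expectation p f = (\<Sum>a\<in>A. pmf p a * f a)"
  using assms by (subst integral_measure_pmf[of A]) auto

lemma fun_vs_dim_empty: "fun_vs.dim ({} :: (nat \<Rightarrow> 'a::field) set) = 0"
  using fun_vs.dim_eq_card_independent[OF fun_vs.independent_empty] by simp

lemma finite_set_replicate_pmf:
  assumes "finite (set_pmf p)"
  shows "finite (set_pmf (replicate_pmf d p))"
proof -
  have "{xs \<in> lists (set_pmf p). length xs = d} = {xs. set xs \<subseteq> set_pmf p \<and> length xs = d}" by auto
  then show ?thesis using finite_lists_length_eq[OF assms] by (simp add: set_replicate_pmf)
qed

text \<open>The independent draws are reordered so that the list comes first and the fresh sample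
  last: one step can then be estimated conditionally on the list.\<close>

lemma replicate_pmf_Suc': "replicate_pmf (Suc d) p = replicate_pmf d p \<bind> (\<lambda>xs. map_pmf (\<lambda>x. x # xs) p)"
  by (simp add: map_pmf_def bind_commute_pmf[of p])

text \<open>
  A coupon-collector argument: as long as the missing dimension is \<open>g\<close>, a fresh sample reduces it with
  probability at least \<open>\<theta> * g\<close>, so the expected missing dimension shrinks by the factor \<open>1 - \<theta>\<close>.
\<close>

lemma prob_not_spanning_le:
  fixes v :: "nat \<Rightarrow> nat \<Rightarrow> 'a::field"
  assumes p: "set_pmf p \<subseteq> {..<m}" and K: "K = fun_vs.dim (v ` {..<m})" "K > 0" and \<theta>: "0 \<le> \<theta>"
    and step: "\<And>S. S \<subseteq> {..<m} \<Longrightarrow>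
      \<theta> * (real K - real (fun_vs.dim (v ` S))) \<le> measure_pmf.prob p {i. v i \<notin> fun_vs.span (v ` S)}"
  shows "measure_pmf.prob (replicate_pmf d p) {I. \<not> v ` {..<m} \<subseteq> fun_vs.span (v ` set I)} \<le> K * exp (- \<theta> * d)"
proof -
  define D where "D I = real K - real (fun_vs.dim (v ` set I))" for I
  have fp: "finite (set_pmf p)" using p finite_subset by blast
  have fin: "finite (set_pmf (replicate_pmf d p))" for d by (rule finite_set_replicate_pmf[OF fp])
  have supp: "set I \<subseteq> {..<m}" if "I \<in> set_pmf (replicate_pmf d p)" for I d
    using that p by (auto simp: set_replicate_pmf)
  \<comment> \<open>With \<open>S\<close> empty, \<open>step\<close> bounds
    \<open>\<theta> * K\<close> by a probability, and \<open>K\<close> is at least 1. So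
    \<open>1 - \<theta>\<close> is nonnegative, as the induction and the power estimate
    require.\<close>
  have \<theta>1: "\<theta> \<le> 1"
  proof -
    have "\<theta> * real K \<le> 1"
      using order_trans[OF step[of "{}"] measure_pmf.prob_le_1] fun_vs_dim_empty[where 'a = 'a] by simp
    moreover have "\<theta> * 1 \<le> \<theta> * real K" using \<theta> K(2) by (intro mult_left_mono) auto
    ultimately show ?thesis by simp
  qed
  have exp_D: "measure_pmf.expectation (replicate_pmf d p) D \<le> real K * (1 - \<theta>) ^ d"
  proof (induction d)
    case 0
    then show ?case
      by (simp add: D_def fun_vs_dim_empty)
  next
    case (Suc d)
    let ?q = "replicate_pmf d p"
    have one: "measure_pmf.expectation (map_pmf (\<lambda>x. x # I) p) D \<le> (1 - \<theta>) * D I"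
      if I: "I \<in> set_pmf ?q" for I
    proof -
      let ?N = "{i. v i \<notin> fun_vs.span (v ` set I)}"
      have "D (x # I) = D I - indicator ?N x" for x
      proof (cases "x \<in> ?N")
        case True
        then have "fun_vs.dim (insert (v x) (v ` set I)) = Suc (fun_vs.dim (v ` set I))"
          by (intro fun_vs_dim_insert) auto
        then show ?thesis using True by (simp add: D_def)
      next
        case False
        then have "fun_vs.span (insert (v x) (v ` set I)) = fun_vs.span (v ` set I)"
          by (intro fun_vs.span_redundant) auto
        then have "fun_vs.dim (insert (v x) (v ` set I)) = fun_vs.dim (v ` set I)"
          by (rule fun_vs.span_eq_dim)
        then show ?thesis using False by (simp add: D_def)
      qed
      then have "measure_pmf.expectation (map_pmf (\<lambda>x. x # I) p) D
          = measure_pmf.expectation p (\<lambda>x. D I - indicator ?N x)" by simp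
      also have "\<dots> = D I - measure_pmf.prob p ?N"
        by (subst Bochner_Integration.integral_diff) (auto intro: integrable_measure_pmf_finite[OF fp])
      also have "\<dots> \<le> D I - \<theta> * D I" using step[OF supp[OF I]] by (simp add: D_def)
      finally show ?thesis by (simp add: algebra_simps)
    qed
    have "measure_pmf.expectation (replicate_pmf (Suc d) p) D =
        (\<Sum>I\<in>set_pmf ?q. pmf ?q I *\<^sub>R measure_pmf.expectation (map_pmf (\<lambda>x. x # I) p) D)"
      unfolding replicate_pmf_Suc' using fp fin by (intro pmf_expectation_bind) auto
    also have "\<dots> \<le> (\<Sum>I\<in>set_pmf ?q. pmf ?q I *\<^sub>R ((1 - \<theta>) * D I))"
      using one by (intro sum_mono scaleR_left_mono) auto
    also have "\<dots> = (1 - \<theta>) * measure_pmf.expectation ?q D"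
      by (subst expectation_finite_sum[OF fin order_refl]) (simp add: sum_distrib_left mult_ac)
    also have "\<dots> \<le> (1 - \<theta>) * (real K * (1 - \<theta>) ^ d)" using Suc \<theta>1 by (intro mult_left_mono) auto
    finally show ?case by (simp add: mult_ac)
  qed
  let ?bad = "{I. \<not> v ` {..<m} \<subseteq> fun_vs.span (v ` set I)}"
  \<comment> \<open>Markov's inequality in pointwise form: the missing dimension is a nonnegative
    integer, and at least 1 if the draws do not span.\<close>
  have "indicator ?bad I \<le> D I" if I: "I \<in> set_pmf (replicate_pmf d p)" for I
  proof (cases "I \<in> ?bad")
    case False
    have "fun_vs.dim (v ` set I) \<le> K"
      unfolding K using supp[OF I] by (intro fun_vs_dim_mono) (auto intro: fun_vs.span_base)
    then show ?thesis using False by (simp add: D_def)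
  next
    case True
    then obtain i where i: "i < m" "v i \<notin> fun_vs.span (v ` set I)" by auto
    have "Suc (fun_vs.dim (v ` set I)) = fun_vs.dim (insert (v i) (v ` set I))"
      using i by (intro fun_vs_dim_insert[symmetric]) auto
    also have "\<dots> \<le> K"
      unfolding K using supp[OF I] i by (intro fun_vs_dim_mono) (auto intro: fun_vs.span_base)
    finally show ?thesis using True by (simp add: D_def)
  qed
  then have "measure_pmf.expectation (replicate_pmf d p) (indicator ?bad) \<le> measure_pmf.expectation (replicate_pmf d p) D"
    by (intro integral_mono_AE integrable_measure_pmf_finite fin) (simp add: AE_measure_pmf_iff)
  then have "measure_pmf.prob (replicate_pmf d p) ?bad \<le> real K * (1 - \<theta>) ^ d" using exp_D by simp
  also have "\<dots> \<le> real K * exp (- \<theta>) ^ d"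
    using \<theta>1 exp_ge_add_one_self[of "- \<theta>"] by (intro mult_left_mono power_mono) auto
  also have "\<dots> = real K * exp (- \<theta> * d)" by (simp add: exp_of_nat_mult[symmetric] mult_ac)
  finally show ?thesis .
qed

text \<open>This is where both universal constants originate. After taking logarithms the target is
  \<open>ln k + x \<le> \<theta> * d\<close> with \<open>x = \<alpha>\<^sup>2 / \<delta>\<close> and
  \<open>\<theta> = \<alpha>\<^sup>2 * s\<^sup>2 / F\<close>.\<close>

lemma sampling_failure_bound:
  fixes r \<epsilon> \<delta> \<alpha> s N F :: real and k d :: nat
  assumes k: "1 \<le> k" and s: "0 < s" and F: "0 < F" "k * s\<^sup>2 \<le> F" and r: "r = F / N\<^sup>2"
    and \<epsilon>: "0 < \<epsilon>" "\<epsilon> < 1" "\<epsilon> < s / N" and \<delta>: "0 < \<delta>" "\<delta> < 1" and \<alpha>: "0 < \<alpha>" "\<alpha> \<le> 1"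
    and d: "2 * (r / (\<epsilon>^4 * \<delta>)) * ln (r / (\<epsilon>^4 * \<delta>)) \<le> d"
    and x: "2 * exp (- (1 / 10) * \<alpha>\<^sup>2 / \<delta>) < 1"
  shows "k * exp (- (\<alpha>\<^sup>2 * s\<^sup>2 / F) * d) \<le> 2 * exp (- (1 / 10) * \<alpha>\<^sup>2 / \<delta>)"
proof -
  define x where "x = \<alpha>\<^sup>2 / \<delta>"
  define Q where "Q = r / (\<epsilon>^4 * \<delta>)"
  \<comment> \<open>The value 1/10 is chosen for this step: a nonvacuous bound forces
    \<open>x > 5\<close>, since \<open>ln (1 / 2) \<le> - 1 / 2\<close>. Exceeding 3 suffices,
    because \<open>Q \<ge> x\<close> then exceeds \<open>exp 1\<close> and \<open>ln Q\<close> is at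
    least 1.\<close>
  have x3: "x > 3"
  proof -
    have "exp (- (1 / 10) * x) < 1 / 2" using x by (simp add: x_def)
    also have "\<dots> = exp (ln (1 / 2))" by simp
    finally have "- (1 / 10) * x < ln (1 / 2)" by (simp only: exp_less_cancel_iff)
    also have "\<dots> \<le> 1 / 2 - 1" by (rule ln_le_minus_one) simp
    finally show ?thesis by simp
  qed
  have N: "N \<noteq> 0" using \<epsilon> by auto
  have r0: "r > 0" using N F by (simp add: r)
  have sN: "\<epsilon>\<^sup>2 \<le> s\<^sup>2 / N\<^sup>2"
  proof -
    have "\<epsilon>\<^sup>2 \<le> (s / N)\<^sup>2" using \<epsilon> by (intro power_mono) auto
    then show ?thesis by (simp add: power_divide)
  qed
  have rk: "k * \<epsilon>\<^sup>2 \<le> r"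
  proof -
    have "k * \<epsilon>\<^sup>2 \<le> k * (s\<^sup>2 / N\<^sup>2)" using sN by (intro mult_left_mono) auto
    also have "\<dots> = k * s\<^sup>2 / N\<^sup>2" by simp
    also have "\<dots> \<le> F / N\<^sup>2" using F(2) by (intro divide_right_mono) auto
    finally show ?thesis by (simp add: r)
  qed
  have e2: "\<epsilon>\<^sup>2 \<le> 1" "\<epsilon>^4 = \<epsilon>\<^sup>2 * \<epsilon>\<^sup>2" using \<epsilon> by (auto simp: power_le_one simp flip: power_add)
  have Qk: "k / \<delta> \<le> Q"
  proof -
    have "k / \<delta> * (\<epsilon>\<^sup>2 * \<epsilon>\<^sup>2 * \<delta>) = (k * \<epsilon>\<^sup>2) * \<epsilon>\<^sup>2" using \<delta> by simp
    also have "\<dots> \<le> (k * \<epsilon>\<^sup>2) * 1" using e2 by (intro mult_left_mono) auto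
    also have "\<dots> \<le> r" using rk by simp
    finally show ?thesis unfolding Q_def e2 using \<epsilon> \<delta> by (simp add: pos_le_divide_eq)
  qed
  have "real k \<le> k / \<delta>" using \<delta> by (simp add: pos_le_divide_eq mult_left_le)
  then have Qk': "k \<le> Q" using Qk by simp
  have "\<alpha>\<^sup>2 \<le> k" using \<alpha> k power_le_one[of \<alpha> 2] by linarith
  then have "x \<le> k / \<delta>" unfolding x_def using \<delta> by (intro divide_right_mono) auto
  then have Q3: "Q > 3" using Qk x3 by linarith
  have "exp 1 \<le> Q" using Q3 exp_le by linarith
  then have lnQ: "1 \<le> ln Q" using Q3 by (subst ln_ge_iff) auto
  have lnk: "ln k \<le> ln Q" using Qk' k by simp
  \<comment> \<open>The constant 2 pays twice: one copy of \<open>x * ln Q\<close> covers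
    \<open>ln k\<close>, Markov's factor, and the other covers the exponent
    \<open>x\<close>.\<close>
  have "ln k + x \<le> 2 * x * ln Q"
  proof -
    have "1 * ln Q \<le> x * ln Q" using x3 lnQ by (intro mult_right_mono) auto
    moreover have "x * 1 \<le> x * ln Q" using x3 lnQ by (intro mult_left_mono) auto
    ultimately show ?thesis using lnk by linarith
  qed
  also have "\<dots> \<le> (\<alpha>\<^sup>2 * s\<^sup>2 / F) * d"
  proof -
    have "2 * x * ln Q \<le> 2 * x / \<epsilon>\<^sup>2 * ln Q"
    proof -
      have "2 * x * \<epsilon>\<^sup>2 \<le> 2 * x * 1" using x3 e2 by (intro mult_left_mono) auto
      then have "2 * x \<le> 2 * x / \<epsilon>\<^sup>2" using \<epsilon> by (simp add: pos_le_divide_eq)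
      then show ?thesis using lnQ by (intro mult_right_mono) auto
    qed
    also have "\<dots> = (\<alpha>\<^sup>2 * \<epsilon>\<^sup>2 / r) * (2 * Q * ln Q)"
      using \<epsilon> \<delta> r0 unfolding Q_def x_def e2 by (simp add: field_simps)
    also have "\<dots> \<le> (\<alpha>\<^sup>2 * \<epsilon>\<^sup>2 / r) * d"
      using d r0 unfolding Q_def by (intro mult_left_mono) auto
    also have "\<dots> \<le> (\<alpha>\<^sup>2 * (s\<^sup>2 / N\<^sup>2) / r) * d"
      using sN r0 by (intro mult_right_mono divide_right_mono mult_left_mono) auto
    \<comment> \<open>\<open>N\<close> cancels between the stable rank and the lower bound for the
      singular value.\<close>
    also have "\<alpha>\<^sup>2 * (s\<^sup>2 / N\<^sup>2) / r = \<alpha>\<^sup>2 * s\<^sup>2 / F" using N by (simp add: r)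
    finally show ?thesis .
  qed
  finally have "exp (- (\<alpha>\<^sup>2 * s\<^sup>2 / F) * d) \<le> exp (- (ln k + x))" by simp
  also have "\<dots> = exp (- x) * exp (- ln k)" by (simp add: exp_add[symmetric])
  also have "exp (- ln k) = 1 / real k" using k by (simp add: exp_minus inverse_eq_divide)
  also have "exp (- x) * (1 / real k) = exp (- x) / k" by simp
  finally have "k * exp (- (\<alpha>\<^sup>2 * s\<^sup>2 / F) * d) \<le> exp (- x)"
    using k by (simp add: pos_le_divide_eq mult.commute)
  also have "\<dots> \<le> exp (- (1 / 10) * x)" using x3 by simp
  also have "\<dots> \<le> 2 * exp (- (1 / 10) * x)" by simp
  finally show ?thesis by (simp add: x_def)
qed

text \<open>Stated for an abstract family \<open>v\<close> with weights \<open>w\<close>, so that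
  rows and columns are two instances.\<close>

lemma spanning_probability:
  fixes v :: "nat \<Rightarrow> nat \<Rightarrow> 'a::field" and w \<alpha> :: "nat \<Rightarrow> real" and m :: nat
  defines "a \<equiv> Min (\<alpha> ` {..<m})"
  assumes p: "set_pmf p \<subseteq> {..<m}" "\<And>i. i < m \<Longrightarrow> 0 < \<alpha> i" "\<And>i. i < m \<Longrightarrow> pmf p i \<ge> (\<alpha> i)\<^sup>2 * (w i / F)"
    and w: "\<And>i. i < m \<Longrightarrow> 0 \<le> w i" "F = (\<Sum>i<m. w i)" "0 < F"
    and k: "k = fun_vs.dim (v ` {..<m})" "1 \<le> k" and s: "0 < s"
    and mass: "\<And>S. S \<subseteq> {..<m} \<Longrightarrow> (real k - real (fun_vs.dim (v ` S))) * s\<^sup>2 \<le>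
        (\<Sum>i | i < m \<and> v i \<notin> fun_vs.span (v ` S). w i)"
    and \<epsilon>: "0 < \<epsilon>" "\<epsilon> < 1" "\<epsilon> < s / N" and \<delta>: "0 < \<delta>" "\<delta> < 1" and r: "r = F / N\<^sup>2"
    and d: "2 * (r / (\<epsilon>^4 * \<delta>)) * ln (r / (\<epsilon>^4 * \<delta>)) \<le> d"
  shows "prob_bound (1 / 10) a \<delta> \<le>
    measure_pmf.prob (replicate_pmf d p) {I. v ` {..<m} \<subseteq> fun_vs.span (v ` set I)}"
proof (cases "2 * exp (- (1 / 10) * a\<^sup>2 / \<delta>) < 1")
  \<comment> \<open>The truncated bound is 0 here. In the other case the nonvacuity is itself an
    assumption of the estimate.\<close>
  case False
  then show ?thesis by (simp add: prob_bound_def)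
next
  case True
  have m: "m > 0" using w by (cases m) auto
  have a: "0 < a" "\<And>i. i < m \<Longrightarrow> a \<le> \<alpha> i"
  proof -
    have "Min (\<alpha> ` {..<m}) \<in> \<alpha> ` {..<m}" using m by (intro Min_in) auto
    then show "0 < a" using p(2) unfolding a_def by fastforce
    show "a \<le> \<alpha> i" if "i < m" for i using that unfolding a_def by (intro Min_le) auto
  qed
  have pm: "a\<^sup>2 * (w i / F) \<le> pmf p i" if "i < m" for i
  proof -
    have "a\<^sup>2 * (w i / F) \<le> (\<alpha> i)\<^sup>2 * (w i / F)"
      using a a(2)[OF that] w(1)[OF that] w(3) by (intro mult_right_mono power_mono) auto
    then show ?thesis using p(3)[OF that] by simp
  qed
  have prob: "a\<^sup>2 / F * (\<Sum>i\<in>S. w i) \<le> measure_pmf.prob p S" if "S \<subseteq> {..<m}" for S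
  proof -
    have fS: "finite S" using that finite_subset by blast
    have "a\<^sup>2 / F * (\<Sum>i\<in>S. w i) = (\<Sum>i\<in>S. a\<^sup>2 * (w i / F))" by (simp add: sum_distrib_left)
    also have "\<dots> \<le> (\<Sum>i\<in>S. pmf p i)" using pm that by (intro sum_mono) auto
    also have "\<dots> = measure_pmf.prob p S" using fS by (rule measure_measure_pmf_finite[symmetric])
    finally show ?thesis .
  qed
  \<comment> \<open>Summed over all indices, the lower bounds on the probabilities give
    \<open>a\<^sup>2\<close>, which cannot exceed the total mass 1.\<close>
  have a1: "a \<le> 1"
  proof -
    have "a\<^sup>2 \<le> 1"
      using order_trans[OF prob[OF order_refl] measure_pmf.prob_le_1] w(2,3) by simp
    then show ?thesis using a(1) by (simp add: abs_square_le_1)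
  qed
  let ?\<theta> = "a\<^sup>2 * s\<^sup>2 / F"
  let ?bad = "{I. \<not> v ` {..<m} \<subseteq> fun_vs.span (v ` set I)}"
  have "measure_pmf.prob (replicate_pmf d p) ?bad \<le> k * exp (- ?\<theta> * d)"
  proof (rule prob_not_spanning_le[OF p(1) k(1)])
    show "0 < k" using k by simp
    show "0 \<le> ?\<theta>" using w by simp
    fix S assume S: "S \<subseteq> {..<m}"
    let ?N = "{i. i < m \<and> v i \<notin> fun_vs.span (v ` S)}"
    have "?\<theta> * (real k - real (fun_vs.dim (v ` S))) = a\<^sup>2 / F * ((real k - real (fun_vs.dim (v ` S))) * s\<^sup>2)"
      by simp
    also have "\<dots> \<le> a\<^sup>2 / F * (\<Sum>i\<in>?N. w i)" using mass[OF S] w(3) by (intro mult_left_mono) auto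
    also have "\<dots> \<le> measure_pmf.prob p ?N" by (rule prob) auto
    also have "\<dots> \<le> measure_pmf.prob p {i. v i \<notin> fun_vs.span (v ` S)}"
      by (intro measure_pmf.finite_measure_mono) auto
    finally show "?\<theta> * (real k - real (fun_vs.dim (v ` S))) \<le> measure_pmf.prob p {i. v i \<notin> fun_vs.span (v ` S)}" .
  qed
  also have "\<dots> \<le> 2 * exp (- (1 / 10) * a\<^sup>2 / \<delta>)"
  proof (rule sampling_failure_bound[OF k(2) s w(3) _ r \<epsilon> \<delta> a(1) a1 d True])
    \<comment> \<open>Before any draw the span is trivial, and the mass estimate compares
      \<open>k * s\<^sup>2\<close> with the total weight.\<close>
    have "real k * s\<^sup>2 \<le> (\<Sum>i | i < m \<and> v i \<notin> fun_vs.span (v ` {}). w i)"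
      using mass[of "{}"] fun_vs_dim_empty[where 'a = 'a] by simp
    also have "\<dots> \<le> (\<Sum>i<m. w i)" using w(1) by (intro sum_mono2) auto
    finally show "real k * s\<^sup>2 \<le> F" using w(2) by simp
  qed
  finally have "1 - 2 * exp (- (1 / 10) * a\<^sup>2 / \<delta>) \<le> 1 - measure_pmf.prob (replicate_pmf d p) ?bad" by simp
  also have "\<dots> = measure_pmf.prob (replicate_pmf d p) (- ?bad)"
    by (subst measure_pmf.prob_compl[symmetric]) (auto simp: Compl_eq_Diff_UNIV)
  also have "- ?bad = {I. v ` {..<m} \<subseteq> fun_vs.span (v ` set I)}" by auto
  finally show ?thesis by (simp add: prob_bound_def)
qed

section \<open>Passage from the scalar field to the complex numbers\<close>

lemma span_map_scalars:
  fixes h :: "'a::field \<Rightarrow> 'b::field"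
  assumes h: "\<And>x y. h (x + y) = h x + h y" "\<And>x y. h (x * y) = h x * h y"
    and v: "v \<in> fun_vs.span B"
  shows "(\<lambda>j. h (v j)) \<in> fun_vs.span ((\<lambda>b j. h (b j)) ` B)"
  using v
proof (induction rule: fun_vs.span_induct_alt)
  case base
  have "h 0 + h 0 = h 0 + 0" using h(1)[of 0 0] by (simp only: add_0_right)
  then have "h 0 = 0" by (simp only: add_left_cancel)
  then have "(\<lambda>j. h ((0 :: nat \<Rightarrow> 'a) j)) = 0" by (auto simp: fun_eq_iff)
  then show ?case by (simp only: fun_vs.span_zero)
next
  case (step c b y)
  have "(\<lambda>j. h (((\<lambda>i. c * b i) + y) j)) = (\<lambda>j. h c * h (b j)) + (\<lambda>j. h (y j))"
    by (simp add: fun_eq_iff h)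
  moreover have "(\<lambda>j. h c * h (b j)) + (\<lambda>j. h (y j)) \<in> fun_vs.span ((\<lambda>b j. h (b j)) ` B)"
    using step by (intro fun_vs.span_add[OF fun_vs.span_scale[OF fun_vs.span_base]]) auto
  ultimately show ?case by (simp only:)
qed

text \<open>A basis over the original field maps to a complex spanning set of no greater size. So
  the complex estimate, applied to that set, is at least as strong as the one claimed with the
  dimension over the original field.\<close>

lemma row_mass_outside_span_scalars:
  fixes h :: "'a::real_normed_field \<Rightarrow> complex" and v :: "nat \<Rightarrow> nat \<Rightarrow> 'a"
  assumes h: "\<And>x y. h (x + y) = h x + h y" "\<And>x y. h (x * y) = h x * h y" "\<And>x. cmod (h x) = norm x"
    and svd: "partial_svd m n (\<lambda>i j. h (v i j)) k \<sigma> e u" and s: "0 < s" "\<And>l. l < k \<Longrightarrow> s \<le> \<sigma> l"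
    and S: "S \<subseteq> {..<m}"
  shows "(real k - real (fun_vs.dim (v ` S))) * s\<^sup>2 \<le>
    (\<Sum>i | i < m \<and> v i \<notin> fun_vs.span (v ` S). \<Sum>j<n. (norm (v i j))\<^sup>2)"
proof -
  obtain B where B: "B \<subseteq> v ` S" "fun_vs.independent B" "v ` S \<subseteq> fun_vs.span B" "card B = fun_vs.dim (v ` S)"
    using fun_vs.basis_exists by blast
  have "finite S" using S by (rule finite_subset) simp
  then have fB: "finite B" by (intro finite_subset[OF B(1)] finite_imageI)
  let ?B = "(\<lambda>b j. h (b j)) ` B"
  \<comment> \<open>All rows in the span, drawn or not: only rows outside it can make the next draw
    useful.\<close>
  define S' where "S' = {i. i < m \<and> v i \<in> fun_vs.span (v ` S)}"
  have "fun_vs.span (v ` S) \<subseteq> fun_vs.span B" using B(3) by (simp add: fun_vs.span_minimal)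
  then have span: "v i \<in> fun_vs.span B" if "i \<in> S'" for i using that by (auto simp: S'_def)
  have "(real k - real (card ?B)) * s\<^sup>2 \<le> (\<Sum>i\<in>{..<m} - S'. \<Sum>j<n. (cmod (h (v i j)))\<^sup>2)"
  proof (rule row_mass_outside_span[OF svd s])
    show "S' \<subseteq> {..<m}" by (auto simp: S'_def)
    show "finite ?B" using fB by simp
    show "(\<lambda>j. h (v i j)) \<in> fun_vs.span ?B" if "i \<in> S'" for i
      by (rule span_map_scalars[of h, OF h(1,2) span[OF that]])
  qed
  moreover have "(real k - real (card B)) * s\<^sup>2 \<le> (real k - real (card ?B)) * s\<^sup>2"
    using card_image_le[OF fB] by (intro mult_right_mono diff_left_mono) auto
  moreover have "{..<m} - S' = {i. i < m \<and> v i \<notin> fun_vs.span (v ` S)}" by (auto simp: S'_def)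
  ultimately show ?thesis by (simp add: h(3) B(4))
qed

lemma mat_rank_pos:
  fixes A :: "'a::field mat"
  assumes A: "A \<in> carrier_mat m n" "A \<noteq> 0\<^sub>m m n"
  shows "1 \<le> mat_rank A"
proof (rule ccontr)
  assume "\<not> 1 \<le> mat_rank A"
  then have d: "fun_vs.dim (row_fun A ` {..<m}) = 0" using A by (simp add: mat_rank_eq_dim_rows)
  obtain B where B: "B \<subseteq> row_fun A ` {..<m}" "fun_vs.independent B" "row_fun A ` {..<m} \<subseteq> fun_vs.span B"
      "card B = fun_vs.dim (row_fun A ` {..<m})"
    using fun_vs.basis_exists by blast
  have "finite B" using B(1) finite_subset by blast
  then have "B = {}" using B(4) d by simp
  then have z: "row_fun A i = 0" if "i < m" for i using B(3) that by auto
  have "A = 0\<^sub>m m n"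
  proof (rule eq_matI)
    fix i j assume "i < dim_row (0\<^sub>m m n :: 'a mat)" "j < dim_col (0\<^sub>m m n :: 'a mat)"
    then show "A $$ (i, j) = 0\<^sub>m m n $$ (i, j)" using fun_cong[OF z[of i], of j] A by (simp add: row_fun_def)
  qed (use A in auto)
  with A show False by blast
qed

text \<open>\<open>h\<close> is a norm-preserving embedding of the scalars into the complex numbers.
  Both scalar fields are instances, with \<open>complex_of_real\<close> and with the
  identity.\<close>

lemma cur_probability:
  fixes A :: "'a::{conjugatable_ordered_field, real_normed_field} mat" and h :: "'a \<Rightarrow> complex"
    and \<alpha> \<beta> :: "nat \<Rightarrow> real"
  assumes h: "\<And>x y. h (x + y) = h x + h y" "\<And>x y. h (x * y) = h x * h y" "\<And>x. cmod (h x) = norm x"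
    and sv: "singular_values (map_mat h A) = singular_values A"
    and A: "A \<in> carrier_mat m n" "A \<noteq> 0\<^sub>m m n"
    and p: "row_sampling A p \<alpha>" and q: "col_sampling A q \<beta>"
    and \<epsilon>: "0 < \<epsilon>" "\<epsilon> < 1" "\<epsilon> < sing_val A (mat_rank A) / spectral_norm A" and \<delta>: "0 < \<delta>" "\<delta> < 1"
    and d1: "2 * (stable_rank A / (\<epsilon>^4 * \<delta>)) * ln (stable_rank A / (\<epsilon>^4 * \<delta>)) \<le> real d1"
    and d2: "2 * (stable_rank A / (\<epsilon>^4 * \<delta>)) * ln (stable_rank A / (\<epsilon>^4 * \<delta>)) \<le> real d2"
  defines "b \<equiv> prob_bound (1 / 10) (Min (\<alpha> ` {..<m})) \<delta> * prob_bound (1 / 10) (Min (\<beta> ` {..<n})) \<delta>"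
  shows "b \<le> measure_pmf.prob (index_pmf d1 p d2 q) {(I, J). exact_cur A I J} \<and>
    b \<le> measure_pmf.prob (index_pmf d1 p d2 q) {(I, J). exact_cur A (remdups I) (remdups J)}"
proof -
  define k where "k = mat_rank A"
  define s where "s = sing_val A k"
  define N where "N = spectral_norm A"
  define F where "F = (frobenius_norm A)\<^sup>2"
  let ?hA = "map_mat h A"
  have h0: "h 0 = 0" using h(1)[of 0 0] by simp
  have hA: "?hA \<in> carrier_mat m n" using A by simp
  \<comment> \<open>These bounds keep the index \<open>k - 1\<close> of \<open>sing_val\<close>
    within the list of \<open>n\<close> singular values.\<close>
  have k: "1 \<le> k" "k \<le> n" using mat_rank_pos[OF A] mat_rank_le_dim_col[of A] A by (auto simp: k_def)
  have s_eq: "sing_val ?hA k = s" by (simp add: s_def sing_val_def sv)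
  have s0: "s \<ge> 0" using sing_val_nonneg[OF hA k] s_eq by simp
  \<comment> \<open>If \<open>s\<close> were 0, the quotient bounding \<epsilon> from above would be
    0, against \<epsilon> > 0.\<close>
  have s: "s > 0" using s0 \<epsilon> by (cases "s = 0") (auto simp: s_def k_def)
  obtain \<sigma> e u where svd: "partial_svd m n (row_fun ?hA) k \<sigma> e u" "\<And>l. l < k \<Longrightarrow> s \<le> \<sigma> l"
    using partial_svd_exists[OF hA k s_eq s] by blast
  have rf: "row_fun ?hA = (\<lambda>i j. h (row_fun A i j))" by (auto simp: row_fun_def fun_eq_iff h0)
  have Fsum: "F = (\<Sum>i<m. \<Sum>j<n. (norm (row_fun A i j))\<^sup>2)"
  proof -
    have "F = (\<Sum>i<m. \<Sum>j<n. (norm (A $$ (i, j)))\<^sup>2)"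
      using A unfolding F_def frobenius_norm_def by (simp add: sum_nonneg)
    also have "\<dots> = (\<Sum>i<m. \<Sum>j<n. (norm (row_fun A i j))\<^sup>2)"
      using A by (intro sum.cong) (auto simp: row_fun_def)
    finally show ?thesis .
  qed
  have F0: "0 < F"
  proof -
    have "F \<noteq> 0"
    proof
      assume "F = 0"
      then have z: "\<forall>i\<in>{..<m}. (\<Sum>j<n. (norm (row_fun A i j))\<^sup>2) = 0"
        unfolding Fsum by (subst (asm) sum_nonneg_eq_0_iff) (auto intro: sum_nonneg)
      have "A = 0\<^sub>m m n"
      proof (rule eq_matI)
        fix i j assume "i < dim_row (0\<^sub>m m n :: 'a mat)" "j < dim_col (0\<^sub>m m n :: 'a mat)"
        then have ij: "i < m" "j < n" by auto
        then have "\<forall>j\<in>{..<n}. (norm (row_fun A i j))\<^sup>2 = 0"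
          using z by (subst sum_nonneg_eq_0_iff[symmetric]) auto
        then show "A $$ (i, j) = 0\<^sub>m m n $$ (i, j)" using ij A by (auto simp: row_fun_def)
      qed (use A in auto)
      with A show False by blast
    qed
    moreover have "0 \<le> F" by (simp add: F_def)
    ultimately show ?thesis by simp
  qed
  have r: "stable_rank A = F / N\<^sup>2" by (simp add: stable_rank_def F_def N_def)
  have \<epsilon>s: "\<epsilon> < s / N" using \<epsilon> by (simp add: s_def k_def N_def)
  have en_row: "(euclid_norm (row A i))\<^sup>2 = (\<Sum>j<n. (norm (row_fun A i j))\<^sup>2)" if "i < m" for i
    using A that unfolding euclid_norm_def by (auto simp: sum_nonneg row_fun_def intro!: sum.cong)
  have en_col: "(euclid_norm (col A j))\<^sup>2 = (\<Sum>i<m. (norm (col_fun A j i))\<^sup>2)" if "j < n" for j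
    using A that unfolding euclid_norm_def by (auto simp: sum_nonneg col_fun_def row_fun_def intro!: sum.cong)
  let ?EI = "{I. row_fun A ` {..<m} \<subseteq> fun_vs.span (row_fun A ` set I)}"
  let ?EJ = "{J. col_fun A ` {..<n} \<subseteq> fun_vs.span (col_fun A ` set J)}"
  have pI: "prob_bound (1 / 10) (Min (\<alpha> ` {..<m})) \<delta> \<le> measure_pmf.prob (replicate_pmf d1 p) ?EI"
  proof (rule spanning_probability[where w = "\<lambda>i. \<Sum>j<n. (norm (row_fun A i j))\<^sup>2",
        OF _ _ _ _ _ F0 _ k(1) s _ \<epsilon>(1,2) \<epsilon>s \<delta> r d1])
    show "set_pmf p \<subseteq> {..<m}" "\<And>i. i < m \<Longrightarrow> 0 < \<alpha> i" using p A by (auto simp: row_sampling_def)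
    show "(\<alpha> i)\<^sup>2 * ((\<Sum>j<n. (norm (row_fun A i j))\<^sup>2) / F) \<le> pmf p i" if "i < m" for i
      using p A that en_row[OF that] by (auto simp: row_sampling_def F_def)
    show "k = fun_vs.dim (row_fun A ` {..<m})" using A by (simp add: k_def mat_rank_eq_dim_rows)
    show "(real k - real (fun_vs.dim (row_fun A ` S))) * s\<^sup>2 \<le>
        (\<Sum>i | i < m \<and> row_fun A i \<notin> fun_vs.span (row_fun A ` S). \<Sum>j<n. (norm (row_fun A i j))\<^sup>2)"
      if "S \<subseteq> {..<m}" for S
      by (rule row_mass_outside_span_scalars[OF h svd(1)[unfolded rf] s svd(2) that])
  qed (simp_all add: Fsum sum_nonneg)
  have pJ: "prob_bound (1 / 10) (Min (\<beta> ` {..<n})) \<delta> \<le> measure_pmf.prob (replicate_pmf d2 q) ?EJ"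
  proof (rule spanning_probability[where w = "\<lambda>j. \<Sum>i<m. (norm (col_fun A j i))\<^sup>2",
        OF _ _ _ _ _ F0 _ k(1) s _ \<epsilon>(1,2) \<epsilon>s \<delta> r d2])
    show "set_pmf q \<subseteq> {..<n}" "\<And>i. i < n \<Longrightarrow> 0 < \<beta> i" using q A by (auto simp: col_sampling_def)
    show "(\<beta> j)\<^sup>2 * ((\<Sum>i<m. (norm (col_fun A j i))\<^sup>2) / F) \<le> pmf q j" if "j < n" for j
      using q A that en_col[OF that] by (auto simp: col_sampling_def F_def)
    show "k = fun_vs.dim (col_fun A ` {..<n})" using A by (simp add: k_def mat_rank_eq_dim_cols)
    show "F = (\<Sum>j<n. \<Sum>i<m. (norm (col_fun A j i))\<^sup>2)"
      unfolding Fsum col_fun_def by (rule sum.swap)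
    show "(real k - real (fun_vs.dim (col_fun A ` S))) * s\<^sup>2 \<le>
        (\<Sum>j | j < n \<and> col_fun A j \<notin> fun_vs.span (col_fun A ` S). \<Sum>i<m. (norm (col_fun A j i))\<^sup>2)"
      if "S \<subseteq> {..<n}" for S
    proof (rule row_mass_outside_span_scalars[OF h _ s svd(2) that])
      show "partial_svd n m (\<lambda>j i. h (col_fun A j i)) k \<sigma> (\<lambda>l i. cnj (u l i)) (\<lambda>l j. cnj (e l j))"
        using partial_svd_transpose[OF svd(1)[unfolded rf]] by (simp add: col_fun_def)
    qed
  qed (simp add: sum_nonneg)
  let ?M = "index_pmf d1 p d2 q"
  \<comment> \<open>The truncation in \<open>prob_bound\<close> supplies the nonnegativity needed to
    multiply the two inequalities.\<close>
  have "b \<le> measure_pmf.prob (replicate_pmf d1 p) ?EI * measure_pmf.prob (replicate_pmf d2 q) ?EJ"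
    unfolding b_def using pI pJ by (intro mult_mono) (auto simp: prob_bound_def)
  also have "\<dots> = measure_pmf.prob ?M (?EI \<times> ?EJ)"
    unfolding index_pmf_def by (rule measure_pmf_prob_product[symmetric]) auto
  \<comment> \<open>Restricting to the support ensures that all listed indices lie within the
    matrix; padded rows and columns are defined for every index.\<close>
  also have "\<dots> = measure_pmf.prob ?M ((?EI \<times> ?EJ) \<inter> set_pmf ?M)"
    by (rule measure_Int_set_pmf[symmetric])
  finally have b: "b \<le> measure_pmf.prob ?M ((?EI \<times> ?EJ) \<inter> set_pmf ?M)" .
  have cur: "exact_cur A I J \<and> exact_cur A (remdups I) (remdups J)"
    if "(I, J) \<in> (?EI \<times> ?EJ) \<inter> set_pmf ?M" for I J
  proof -
    have "set I \<subseteq> set_pmf p" "set J \<subseteq> set_pmf q"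
      using that by (auto simp: index_pmf_def set_replicate_pmf)
    then have sub: "set I \<subseteq> {..<m}" "set J \<subseteq> {..<n}"
      using p q A by (auto simp: row_sampling_def col_sampling_def)
    have "row_fun A ` {..<m} \<subseteq> fun_vs.span (row_fun A ` set I)"
      "col_fun A ` {..<n} \<subseteq> fun_vs.span (col_fun A ` set J)" using that by auto
    then show ?thesis using sub by (auto intro!: exact_cur_if_spanning[OF A(1)])
  qed
  have "measure_pmf.prob ?M ((?EI \<times> ?EJ) \<inter> set_pmf ?M) \<le> measure_pmf.prob ?M {(I, J). exact_cur A I J}"
    "measure_pmf.prob ?M ((?EI \<times> ?EJ) \<inter> set_pmf ?M) \<le>
      measure_pmf.prob ?M {(I, J). exact_cur A (remdups I) (remdups J)}"
    using cur by (intro measure_pmf.finite_measure_mono; auto)+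
  then show ?thesis using b by linarith
qed

theorem theorem6p4:
  shows "\<exists>(C0::real) (c::real). C0 > 0 \<and> c > 0 \<and>
     (\<forall>(m::nat) (n::nat) (A::real mat) (p::nat pmf) (q::nat pmf) (\<alpha>::nat \<Rightarrow> real) (\<beta>::nat \<Rightarrow> real)
          (\<epsilon>::real) (\<delta>::real) (d1::nat) (d2::nat).
        let r = stable_rank A; k = mat_rank A;
            \<alpha>min = Min (\<alpha> ` {..<m}); \<beta>min = Min (\<beta> ` {..<n})
        in
          A \<in> carrier_mat m n \<longrightarrow> A \<noteq> 0\<^sub>m m n \<longrightarrow>
          row_sampling A p \<alpha> \<longrightarrow> col_sampling A q \<beta> \<longrightarrow>
          \<epsilon> \<in> {0<..<1} \<longrightarrow> \<delta> \<in> {0<..<1} \<longrightarrow>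
          \<epsilon>\<^sup>2 * sqrt \<delta> / 2 < min \<alpha>min \<beta>min \<longrightarrow>
          \<epsilon> < sing_val A k / spectral_norm A \<longrightarrow>
          d1 \<in> {1..m} \<longrightarrow> d2 \<in> {1..n} \<longrightarrow>
          real d1 \<ge> C0 * (r / (\<epsilon>^4 * \<delta>)) * ln (r / (\<epsilon>^4 * \<delta>)) \<longrightarrow>
          real d2 \<ge> C0 * (r / (\<epsilon>^4 * \<delta>)) * ln (r / (\<epsilon>^4 * \<delta>)) \<longrightarrow>
          measure_pmf.prob (index_pmf d1 p d2 q) {(I, J). exact_cur A I J}
            \<ge> prob_bound c \<alpha>min \<delta> * prob_bound c \<beta>min \<delta> \<and>
          measure_pmf.prob (index_pmf d1 p d2 q) {(I, J). exact_cur A (remdups I) (remdups J)}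
            \<ge> prob_bound c \<alpha>min \<delta> * prob_bound c \<beta>min \<delta>) \<and>
     (\<forall>(m::nat) (n::nat) (A::complex mat) (p::nat pmf) (q::nat pmf) (\<alpha>::nat \<Rightarrow> real) (\<beta>::nat \<Rightarrow> real)
          (\<epsilon>::real) (\<delta>::real) (d1::nat) (d2::nat).
        let r = stable_rank A; k = mat_rank A;
            \<alpha>min = Min (\<alpha> ` {..<m}); \<beta>min = Min (\<beta> ` {..<n})
        in
          A \<in> carrier_mat m n \<longrightarrow> A \<noteq> 0\<^sub>m m n \<longrightarrow>
          row_sampling A p \<alpha> \<longrightarrow> col_sampling A q \<beta> \<longrightarrow>
          \<epsilon> \<in> {0<..<1} \<longrightarrow> \<delta> \<in> {0<..<1} \<longrightarrow>
          \<epsilon>\<^sup>2 * sqrt \<delta> / 2 < min \<alpha>min \<beta>min \<longrightarrow>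
          \<epsilon> < sing_val A k / spectral_norm A \<longrightarrow>
          d1 \<in> {1..m} \<longrightarrow> d2 \<in> {1..n} \<longrightarrow>
          real d1 \<ge> C0 * (r / (\<epsilon>^4 * \<delta>)) * ln (r / (\<epsilon>^4 * \<delta>)) \<longrightarrow>
          real d2 \<ge> C0 * (r / (\<epsilon>^4 * \<delta>)) * ln (r / (\<epsilon>^4 * \<delta>)) \<longrightarrow>
          measure_pmf.prob (index_pmf d1 p d2 q) {(I, J). exact_cur A I J}
            \<ge> prob_bound c \<alpha>min \<delta> * prob_bound c \<beta>min \<delta> \<and>
          measure_pmf.prob (index_pmf d1 p d2 q) {(I, J). exact_cur A (remdups I) (remdups J)}
            \<ge> prob_bound c \<alpha>min \<delta> * prob_bound c \<beta>min \<delta>)"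
proof (rule exI[of _ 2], rule exI[of _ "1 / 10"], intro conjI allI, goal_cases)
  case (3 m n A p q \<alpha> \<beta> \<epsilon> \<delta> d1 d2)
  then show ?case
    unfolding Let_def
    by (intro impI cur_probability[where h = complex_of_real])
      (simp_all add: singular_values_map_of_real)
next
  case (4 m n A p q \<alpha> \<beta> \<epsilon> \<delta> d1 d2)
  have "map_mat (\<lambda>x. x) A = A" by (rule eq_matI) auto
  with 4 show ?case
    unfolding Let_def by (intro impI cur_probability[where h = "\<lambda>x. x"]) simp_all
qed simp_all

end
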